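(* Suppose $P_0\succ0$ and $G_kG_k^\top\succ0$ for all $k=0,\dots,N-1$. Let $K$ (together with a feedforward $\bm v$) be an optimal solution of $$\min_{\bm v,K}\ J(\bm v,K)\quad\text{s.t.}\quad g_x(\mathbb{E}[x_k],\mathrm{Cov}(x_k))\le 0\ (k=1,\dots,N),\quad g_u(\mathbb{E}[u_k],\mathrm{Cov}(u_k))\le 0\ (k=0,\dots,N-1),\quad K\text{ block lower triangular},$$ with $g_x,g_u$ covariance-monotonic. Let $H_k=P_{ux,k}P_{x,k}^\dagger$, $k=0,\dots,N-1$, be computed from the moments under $(\bm v,K)$, and let $$K_M=\begin{bmatrix}\mathrm{blkdiag}(H_0,H_1,\dots,H_{N-1}) & 0_{mN\times n}\end{bmatrix}.$$ Then $K=K_M$.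
   Context: System: for $k=0,\dots,N-1$, $x_{k+1}=A_kx_k+B_ku_k+G_kw_k$ with $x_k\in\mathbb{R}^n$, $u_k\in\mathbb{R}^m$, $w_k\in\mathbb{R}^l$, where $w_0,\dots,w_{N-1}$ are i.i.d. $\mathcal N(0,I_l)$, and $x_0\sim\mathcal N(\mu_0,P_0)$, $P_0\succeq0$, is independent of $\{w_k\}$. State-history-affine policy: $u_k=v_k+\sum_{i=0}^kK_{k,i}(x_i-\mathbb{E}[x_i])$, with $v_k\in\mathbb{R}^m$, $K_{k,i}\in\mathbb{R}^{m\times n}$; $\bm v=[v_0^\top,\dots,v_{N-1}^\top]^\top$, and $K\in\mathbb{R}^{mN\times n(N+1)}$ is the block matrix whose $(k,i)$ block ($0\le k\le N-1$, $0\le i\le N$) is $K_{k,i}$ if $i\le k$ and $0$ if $i>k$ ("block lower triangular"; the last block column is zero). Under this policy, $\mu_k=\mathbb{E}[x_k]$, $v_k=\mathbb{E}[u_k]$, $P_{x,k}=\mathrm{Cov}(x_k)$, $P_{u,k}=\mathrm{Cov}(u_k)$, $P_{ux,k}=\mathbb{E}[(u_k-v_k)(x_k-\mu_k)^\top]$. Cost: $J=\sum_{k=0}^N\mathbb{E}[x_k^\top Q_kx_k]+\sum_{k=0}^{N-1}\mathbb{E}[u_k^\top R_ku_k]$ with $Q_k\succeq0$, $R_k\succ0$ symmetric. Covariance-monotonic: a function $g:\mathbb{R}^d\times\mathbb{S}_+^d\to\mathbb{R}$ ($\mathbb{S}^d_+$ = symmetric positive semidefinite $d\times d$ matrices) defining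 a constraint $g(\mu,P)\le0$ is covariance-monotonic if $P_1\preceq P_2$ implies $g(\mu,P_1)\le g(\mu,P_2)$ for every $\mu$. Here $g_x$ is defined on $\mathbb{R}^n\times\mathbb{S}_+^n$ and $g_u$ on $\mathbb{R}^m\times\mathbb{S}_+^m$. $X^\dagger$ denotes the Moore–Penrose pseudoinverse. *)

theory Defs
  imports "HOL-Probability.Probability"
begin

section \<open>Positive (semi)definite matrices and the Moore--Penrose pseudoinverse\<close>

definition psd :: "real^'d^'d \<Rightarrow> bool" where
  "psd P \<longleftrightarrow> transpose P = P \<and> (\<forall>x. 0 \<le> x \<bullet> (P *v x))"

definition pd :: "real^'d^'d \<Rightarrow> bool" where
  "pd P \<longleftrightarrow> transpose P = P \<and> (\<forall>x. x \<noteq> 0 \<longrightarrow> 0 < x \<bullet> (P *v x))"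

definition loewner_le :: "real^'d^'d \<Rightarrow> real^'d^'d \<Rightarrow> bool" where
  "loewner_le P1 P2 \<longleftrightarrow> psd (P2 - P1)"

definition is_pinv :: "real^'n^'m \<Rightarrow> real^'m^'n \<Rightarrow> bool" where
  "is_pinv A X \<longleftrightarrow>
     A ** X ** A = A \<and> X ** A ** X = X \<and>
     transpose (A ** X) = A ** X \<and> transpose (X ** A) = X ** A"

definition pinv :: "real^'n^'m \<Rightarrow> real^'m^'n" where
  "pinv A = (THE X. is_pinv A X)"

lemma is_pinv_unique:
  assumes X: "is_pinv A X" and Y: "is_pinv A Y"
  shows "X = Y"
proof -
  have "A ** X = transpose ((A ** Y) ** (A ** X))"
    using X Y by (simp add: is_pinv_def matrix_mul_assoc)
  also have "\<dots> = (A ** X) ** (A ** Y)"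
    using X Y by (simp add: is_pinv_def matrix_transpose_mul)
  also have "\<dots> = A ** Y"
    using X by (simp add: is_pinv_def matrix_mul_assoc)
  finally have AX: "A ** X = A ** Y" .
  have "X ** A = transpose ((X ** A) ** (Y ** A))"
    using X Y by (simp add: is_pinv_def) (metis matrix_mul_assoc)
  also have "\<dots> = (Y ** A) ** (X ** A)"
    using X Y by (simp add: is_pinv_def matrix_transpose_mul)
  also have "\<dots> = Y ** A"
    using X by (simp add: is_pinv_def) (metis matrix_mul_assoc)
  finally have XA: "X ** A = Y ** A" .
  have "X = X ** A ** X" using X by (simp add: is_pinv_def)
  also have "\<dots> = Y ** (A ** X)" by (simp add: XA matrix_mul_assoc)
  also have "\<dots> = Y" using Y by (simp add: AX is_pinv_def matrix_mul_assoc)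
  finally show ?thesis .
qed

lemma pinv_eqI: "is_pinv A X \<Longrightarrow> pinv A = X"
  unfolding pinv_def by (blast intro: is_pinv_unique)


section \<open>Random vectors\<close>

abbreviation mean :: "'a measure \<Rightarrow> ('a \<Rightarrow> real^'d) \<Rightarrow> real^'d" where
  "mean M X \<equiv> integral\<^sup>L M X"

definition cross_cov :: "'a measure \<Rightarrow> ('a \<Rightarrow> real^'m) \<Rightarrow> ('a \<Rightarrow> real^'n) \<Rightarrow> real^'n^'m" where
  "cross_cov M X Y =
     integral\<^sup>L M (\<lambda>\<omega>. \<chi> i j. (X \<omega> - mean M X) $ i * (Y \<omega> - mean M Y) $ j)"

abbreviation cov :: "'a measure \<Rightarrow> ('a \<Rightarrow> real^'d) \<Rightarrow> real^'d^'d" where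
  "cov M X \<equiv> cross_cov M X X"

text \<open>A random vector is Gaussian if all its linear functionals are univariate normal; a
  functional of variance 0 is a point mass, so singular covariance matrices are covered.\<close>

definition gaussian :: "'a measure \<Rightarrow> ('a \<Rightarrow> real^'d) \<Rightarrow> real^'d \<Rightarrow> real^'d^'d \<Rightarrow> bool" where
  "gaussian M X \<mu> P \<longleftrightarrow>
     psd P \<and> X \<in> borel_measurable M \<and>
     (\<forall>a. if a \<bullet> (P *v a) = 0 then (AE \<omega> in M. a \<bullet> X \<omega> = a \<bullet> \<mu>)
          else distributed M lborel (\<lambda>\<omega>. a \<bullet> X \<omega>)
                 (normal_density (a \<bullet> \<mu>) (sqrt (a \<bullet> (P *v a)))))"

text \<open>\<open>x0\<close> is independent of the whole sequence \<open>w 0, \<dots>, w (N - 1)\<close>. The library's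
  \<open>indep_var\<close> needs both variables to have the same codomain type, hence the
  generated \<open>\<sigma>\<close>-algebras.\<close>

definition noise_model ::
  "'a measure \<Rightarrow> nat \<Rightarrow> real^'n \<Rightarrow> real^'n^'n \<Rightarrow> ('a \<Rightarrow> real^'n) \<Rightarrow> (nat \<Rightarrow> 'a \<Rightarrow> real^'l) \<Rightarrow> bool"
where
  "noise_model M N \<mu>0 P0 x0 w \<longleftrightarrow>
     prob_space M \<and>
     gaussian M x0 \<mu>0 P0 \<and>
     (\<forall>k<N. gaussian M (w k) 0 (mat 1)) \<and>
     prob_space.indep_vars M (\<lambda>_. borel) w {..<N} \<and>
     prob_space.indep_set M
       (sets (vimage_algebra (space M) x0 borel))
       (sets (vimage_algebra (space M) (\<lambda>\<omega>. \<lambda>k\<in>{..<N}. w k \<omega>) (PiM {..<N} (\<lambda>_. borel))))"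


section \<open>Closed loop under a state-history-affine policy\<close>

definition history_policy ::
  "'a measure \<Rightarrow> (nat \<Rightarrow> real^'m) \<Rightarrow> (nat \<Rightarrow> nat \<Rightarrow> real^'n^'m) \<Rightarrow>
   (nat \<Rightarrow> 'a \<Rightarrow> real^'n) \<Rightarrow> nat \<Rightarrow> 'a \<Rightarrow> real^'m"
where
  "history_policy M v K x k \<omega> = v k + (\<Sum>i\<le>k. K k i *v (x i \<omega> - mean M (x i)))"

lemma history_policy_cong [fundef_cong]:
  assumes "M = M'" "v = v'" "K = K'" "k = k'" "\<omega> = \<omega>'" "\<And>i. i \<le> k' \<Longrightarrow> x i = x' i"
  shows "history_policy M v K x k \<omega> = history_policy M' v' K' x' k' \<omega>'"
  using assms by (simp add: history_policy_def)

context
  fixes M :: "'a measure"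
    and A :: "nat \<Rightarrow> real^'n^'n" and B :: "nat \<Rightarrow> real^'m^'n" and G :: "nat \<Rightarrow> real^'l^'n"
    and x0 :: "'a \<Rightarrow> real^'n" and w :: "nat \<Rightarrow> 'a \<Rightarrow> real^'l"
    and v :: "nat \<Rightarrow> real^'m" and K :: "nat \<Rightarrow> nat \<Rightarrow> real^'n^'m"
begin

fun state :: "nat \<Rightarrow> 'a \<Rightarrow> real^'n" where
  "state 0 = x0"
| "state (Suc k) =
     (\<lambda>\<omega>. A k *v state k \<omega> + B k *v history_policy M v K (\<lambda>i. state i) k \<omega> + G k *v w k \<omega>)"

definition control :: "nat \<Rightarrow> 'a \<Rightarrow> real^'m" where
  "control k = history_policy M v K state k"

definition cost :: "nat \<Rightarrow> (nat \<Rightarrow> real^'n^'n) \<Rightarrow> (nat \<Rightarrow> real^'m^'m) \<Rightarrow> real" where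
  "cost N Q R =
     (\<Sum>k\<le>N. integral\<^sup>L M (\<lambda>\<omega>. state k \<omega> \<bullet> (Q k *v state k \<omega>))) +
     (\<Sum>k<N. integral\<^sup>L M (\<lambda>\<omega>. control k \<omega> \<bullet> (R k *v control k \<omega>)))"

definition regression_gain :: "nat \<Rightarrow> real^'n^'m" where
  "regression_gain k = cross_cov M (control k) (state k) ** pinv (cov M (state k))"

end


section \<open>The constrained optimal control problem\<close>

text \<open>Only the values on \<open>\<real>\<^sup>d \<times> \<S>\<^sub>+\<^sup>d\<close> matter.\<close>

definition covariance_monotonic :: "(real^'d \<Rightarrow> real^'d^'d \<Rightarrow> real) \<Rightarrow> bool" where
  "covariance_monotonic g \<longleftrightarrow>
     (\<forall>\<mu> P1 P2. psd P1 \<and> psd P2 \<and> loewner_le P1 P2 \<longrightarrow> g \<mu> P1 \<le> g \<mu> P2)"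

text \<open>An \<open>mN \<times> n(N+1)\<close> matrix is represented by its blocks \<open>K k i\<close>, \<open>k < N\<close>, \<open>i \<le> N\<close>;
  entries outside this range are meaningless.\<close>

definition block_lower_triangular :: "nat \<Rightarrow> (nat \<Rightarrow> nat \<Rightarrow> real^'n^'m) \<Rightarrow> bool" where
  "block_lower_triangular N K \<longleftrightarrow> (\<forall>k<N. \<forall>i\<le>N. k < i \<longrightarrow> K k i = 0)"

definition block_matrix_eq ::
  "nat \<Rightarrow> (nat \<Rightarrow> nat \<Rightarrow> real^'n^'m) \<Rightarrow> (nat \<Rightarrow> nat \<Rightarrow> real^'n^'m) \<Rightarrow> bool"
where
  "block_matrix_eq N K L \<longleftrightarrow> (\<forall>k<N. \<forall>i\<le>N. K k i = L k i)"

text \<open>The block matrix \<open>[blkdiag (H 0, \<dots>, H (N - 1)) | 0]\<close>.\<close>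

definition blkdiag_zero :: "nat \<Rightarrow> (nat \<Rightarrow> real^'n^'m) \<Rightarrow> nat \<Rightarrow> nat \<Rightarrow> real^'n^'m" where
  "blkdiag_zero N H k i = (if i < N \<and> i = k then H k else 0)"

context
  fixes M :: "'a measure" and N :: nat
    and A :: "nat \<Rightarrow> real^'n^'n" and B :: "nat \<Rightarrow> real^'m^'n" and G :: "nat \<Rightarrow> real^'l^'n"
    and x0 :: "'a \<Rightarrow> real^'n" and w :: "nat \<Rightarrow> 'a \<Rightarrow> real^'l"
    and gx :: "real^'n \<Rightarrow> real^'n^'n \<Rightarrow> real" and gu :: "real^'m \<Rightarrow> real^'m^'m \<Rightarrow> real"
begin

definition feasible :: "(nat \<Rightarrow> real^'m) \<Rightarrow> (nat \<Rightarrow> nat \<Rightarrow> real^'n^'m) \<Rightarrow> bool" where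
  "feasible v K \<longleftrightarrow>
     (\<forall>k\<in>{1..N}. gx (mean M (state M A B G x0 w v K k)) (cov M (state M A B G x0 w v K k)) \<le> 0) \<and>
     (\<forall>k<N. gu (mean M (control M A B G x0 w v K k)) (cov M (control M A B G x0 w v K k)) \<le> 0) \<and>
     block_lower_triangular N K"

definition optimal ::
  "(nat \<Rightarrow> real^'n^'n) \<Rightarrow> (nat \<Rightarrow> real^'m^'m) \<Rightarrow>
   (nat \<Rightarrow> real^'m) \<Rightarrow> (nat \<Rightarrow> nat \<Rightarrow> real^'n^'m) \<Rightarrow> bool"
where
  "optimal Q R v K \<longleftrightarrow>
     feasible v K \<and>
     (\<forall>v' K'. feasible v' K' \<longrightarrow>
        cost M A B G x0 w v K N Q R \<le> cost M A B G x0 w v' K' N Q R)"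

end

end

theory Submission
  imports Defs
begin

text \<open>Split the centred control as \<open>H\<^sub>k x\<^sub>k + e\<^sub>k\<close> with \<open>H\<^sub>k\<close> the regression gain, so that \<open>e\<^sub>k\<close> is
  orthogonal to the centred state \<open>x\<^sub>k\<close>. Dropping every \<open>e\<^sub>k\<close> gives the policy \<open>K\<^sub>M\<close>: it keeps the
  means and, by Pythagoras and induction on \<open>k\<close>, does not increase any covariance in the Loewner
  order. Hence it stays feasible, and its cost is smaller by at least \<open>\<Sum>k. E[e\<^sub>k\<^sup>T R\<^sub>k e\<^sub>k]\<close>. At an optimum
  therefore \<open>e\<^sub>k = 0\<close> almost surely. Since \<open>P\<^sub>0\<close> and all \<open>G\<^sub>k G\<^sub>k\<^sup>T\<close> are positive definite, the
  components of \<open>x\<^sub>0, \<dots>, x\<^sub>k\<close> are linearly independent, so the representation of \<open>e\<^sub>k\<close> by the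
  state history vanishes coefficientwise, which is \<open>K = K\<^sub>M\<close>.\<close>

section \<open>Positive semidefinite matrices\<close>

lemma inner_matrix_vector_mult_left: "a \<bullet> (A *v b) = (transpose A *v a) \<bullet> b"
  for A :: "real^'n^'m"
  by (metis dot_lmul_matrix transpose_matrix_vector)

lemma inner_symmetric_matrix:
  fixes P :: "real^'d^'d"
  assumes "transpose P = P"
  shows "x \<bullet> (P *v y) = y \<bullet> (P *v x)"
  using inner_matrix_vector_mult_left[of x P y] assms by (simp add: inner_commute)

text \<open>Along the line \<open>x - t *\<^sub>R (P *v x)\<close> the quadratic form is
  \<open>c * t^2 - 2 * t * n\<close> with \<open>n\<close> the squared norm of
  \<open>P *v x\<close>. Near \<open>t = 0\<close> the linear term dominates, so nonnegativity for
  all \<open>t\<close> forces \<open>n = 0\<close>.\<close>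

lemma psd_quadratic_zero_imp_kernel:
  fixes P :: "real^'d^'d"
  assumes "psd P" "x \<bullet> (P *v x) = 0"
  shows "P *v x = 0"
proof -
  define c where "c = (P *v x) \<bullet> (P *v (P *v x))"
  define n where "n = (P *v x) \<bullet> (P *v x)"
  have sym: "x \<bullet> (P *v (P *v x)) = n"
    using inner_symmetric_matrix[of P x "P *v x"] assms(1) by (simp add: psd_def n_def)
  have ge: "0 \<le> c * t^2 - 2 * t * n" for t
  proof -
    have "0 \<le> (x - t *\<^sub>R (P *v x)) \<bullet> (P *v (x - t *\<^sub>R (P *v x)))"
      using assms(1) by (auto simp: psd_def)
    also have "\<dots> = c * t^2 - 2 * t * n"
      using assms(2) sym
      by (simp add: matrix_vector_mult_diff_distrib matrix_vector_mult_scaleR inner_diff_left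
          inner_diff_right c_def n_def power2_eq_square algebra_simps)
    finally show ?thesis .
  qed
  have "n \<le> 0"
  proof (rule ccontr)
    assume "\<not> n \<le> 0"
    then have n: "n > 0" by simp
    have c: "0 \<le> c" using assms(1) by (simp add: psd_def c_def)
    \<comment> \<open>The minimiser would be \<open>n / c\<close>; the denominator
      \<open>c + 1\<close> covers \<open>c = 0\<close> as well and still makes the value
      negative.\<close>
    have "0 \<le> c * (n / (c + 1))^2 - 2 * (n / (c + 1)) * n" by (rule ge)
    also have "\<dots> = (n / (c + 1))^2 * (c - 2 * (c + 1))"
      using c by (simp add: power2_eq_square divide_simps) (simp add: algebra_simps)
    also have "\<dots> < 0" using n c by (intro mult_pos_neg) auto
    finally show False by simp
  qed
  then show ?thesis unfolding n_def by (metis inner_gt_zero_iff not_le)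
qed

text \<open>Cholesky elimination: subtracting \<open>p p\<^sup>T / P\<^sub>i\<^sub>i\<close>, where \<open>p\<close> is the \<open>i\<close>-th column, keeps \<open>P\<close>
  positive semidefinite and clears row and column \<open>i\<close>.\<close>

lemma psd_sum_of_squares_on:
  fixes P :: "real^'d^'d"
  assumes "finite J" "psd P" "\<And>i. i \<notin> J \<Longrightarrow> P *v axis i 1 = 0"
  shows "\<exists>q. \<forall>x. x \<bullet> (P *v x) = (\<Sum>i\<in>J. (q i \<bullet> x)\<^sup>2)"
  using assms
proof (induction J arbitrary: P rule: finite_induct)
  case empty
  have "P *v x = 0" for x
  proof -
    have "P *v x = P *v (\<Sum>i\<in>UNIV. x $ i *s axis i 1)"
      by (simp add: basis_expansion)
    also have "\<dots> = (\<Sum>i\<in>UNIV. x $ i *s (P *v axis i 1))"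
      by (simp add: linear_sum matrix_vector_mult_scaleR scalar_mult_eq_scaleR)
    finally show ?thesis using empty by simp
  qed
  then show ?case by simp
next
  case (insert i J)
  define p where "p = P *v axis i 1"
  define d where "d = axis i 1 \<bullet> p"
  have d0: "0 \<le> d" using insert.prems(1) by (simp add: psd_def d_def p_def)
  have p: "axis i 1 \<bullet> (P *v x) = p \<bullet> x" for x
    using insert.prems(1) inner_symmetric_matrix[of P "axis i 1" x]
    by (simp add: psd_def p_def inner_commute)
  show ?case
  proof (cases "d = 0")
    case True
    then have "P *v axis i 1 = 0"
      using psd_quadratic_zero_imp_kernel[OF insert.prems(1)] by (simp add: d_def p_def)
    then obtain q where q: "\<And>x. x \<bullet> (P *v x) = (\<Sum>i\<in>J. (q i \<bullet> x)\<^sup>2)"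
      using insert.IH[OF insert.prems(1)] insert.prems(2) by (metis insert_iff)
    \<comment> \<open>A zero pivot means that column \<open>i\<close> of \<open>P\<close> already
      vanishes, so index \<open>i\<close> contributes the zero functional.\<close>
    have "x \<bullet> (P *v x) = (\<Sum>j\<in>insert i J. ((q(i := 0)) j \<bullet> x)\<^sup>2)" for x
      using insert.hyps by (simp add: q, intro sum.cong) auto
    then show ?thesis by blast
  next
    case False
    define P' :: "real^'d^'d" where "P' = (\<chi> r c. P $ r $ c - p $ r * p $ c / d)"
    have P': "P' *v x = P *v x - ((p \<bullet> x) / d) *\<^sub>R p" for x
      by (simp add: vec_eq_iff P'_def matrix_vector_mult_def inner_vec_def left_diff_distrib right_diff_distrib
          sum_subtractf sum_divide_distrib sum_distrib_left sum_distrib_right mult_ac)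
    have "psd P'"
      unfolding psd_def
    proof (intro conjI allI)
      have "P $ r $ c = P $ c $ r" for r c
        using insert.prems(1) by (simp add: psd_def transpose_def vec_eq_iff)
      then show "transpose P' = P'"
        by (simp add: P'_def transpose_def vec_eq_iff)
      fix x
      \<comment> \<open>The shift along axis \<open>i\<close> is chosen so that \<open>P\<close>
        maps \<open>z\<close> to \<open>P' *v x\<close>. Since row \<open>i\<close> of
        \<open>P'\<close> is zero, the form of \<open>P'\<close> at \<open>x\<close> equals that of
        \<open>P\<close> at \<open>z\<close> and is nonnegative.\<close>
      define z where "z = x - ((p \<bullet> x) / d) *\<^sub>R axis i 1"
      have pz: "P *v z = P' *v x"
        by (simp add: z_def P' matrix_vector_mult_diff_distrib matrix_vector_mult_scaleR p_def)
      have "0 \<le> z \<bullet> (P *v z)" using insert.prems(1) by (simp add: psd_def)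
      also have "z \<bullet> (P *v z) = x \<bullet> (P' *v x) - (p \<bullet> x) / d * (axis i 1 \<bullet> (P' *v x))"
        unfolding pz by (simp add: z_def inner_diff_left)
      also have "axis i 1 \<bullet> (P' *v x) = 0"
        using False by (simp add: P' inner_diff_right p d_def[symmetric])
      finally show "0 \<le> x \<bullet> (P' *v x)" by simp
    qed
    moreover have "P' *v axis j 1 = 0" if "j \<notin> J" for j
    proof (cases "j = i")
      case True
      then show ?thesis using False by (simp add: P' p_def[symmetric] d_def inner_commute)
    next
      case j: False
      then have "P *v axis j 1 = 0" using insert.prems(2) that by blast
      moreover from this have "p \<bullet> axis j 1 = 0" using p[of "axis j 1"] by simp
      ultimately show ?thesis by (simp add: P')
    qed
    ultimately obtain q where q: "\<And>x. x \<bullet> (P' *v x) = (\<Sum>i\<in>J. (q i \<bullet> x)\<^sup>2)"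
      using insert.IH by metis
    \<comment> \<open>The rank-one term taken away from \<open>P\<close> is the square of the
      functional given by \<open>p\<close> divided by \<open>sqrt d\<close>.\<close>
    have "x \<bullet> (P *v x) = (\<Sum>j\<in>insert i J. ((q(i := (1 / sqrt d) *\<^sub>R p)) j \<bullet> x)\<^sup>2)" for x
    proof -
      have "(\<Sum>j\<in>insert i J. ((q(i := (1 / sqrt d) *\<^sub>R p)) j \<bullet> x)\<^sup>2)
          = ((1 / sqrt d) *\<^sub>R p \<bullet> x)\<^sup>2 + (\<Sum>j\<in>J. (q j \<bullet> x)\<^sup>2)"
        using insert.hyps by (simp, intro sum.cong) auto
      also have "\<dots> = (p \<bullet> x)\<^sup>2 / d + x \<bullet> (P' *v x)"
        using d0 by (simp add: q power_divide)
      also have "\<dots> = x \<bullet> (P *v x)"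
        by (simp add: P' inner_diff_right power2_eq_square inner_commute)
      finally show ?thesis by simp
    qed
    then show ?thesis by blast
  qed
qed

text \<open>This turns the expectation of a quadratic form into a sum of second moments of scalar
  functionals, which can be compared one by one.\<close>

lemma psd_sum_of_squares:
  fixes P :: "real^'d^'d"
  assumes "psd P"
  shows "\<exists>q :: 'd \<Rightarrow> real^'d. \<forall>x. x \<bullet> (P *v x) = (\<Sum>i\<in>UNIV. (q i \<bullet> x)\<^sup>2)"
  by (rule psd_sum_of_squares_on) (use assms in auto)

lemma pd_imp_psd: "pd P \<Longrightarrow> psd P"
  unfolding pd_def psd_def by (metis inner_zero_left less_eq_real_def)

lemma pd_quadratic_eq_0_iff: "pd P \<Longrightarrow> x \<bullet> (P *v x) = 0 \<longleftrightarrow> x = 0"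
  unfolding pd_def by (metis inner_zero_left less_irrefl)

text \<open>A trivial kernel gives a left inverse, which for a square matrix is two-sided and so
  satisfies the Penrose equations; uniqueness identifies it with \<open>pinv P\<close>.\<close>

lemma pd_pinv_mult:
  fixes P :: "real^'d^'d"
  assumes "pd P"
  shows "pinv P ** P = mat 1"
proof -
  have "x = 0" if "P *v x = 0" for x
    using that pd_quadratic_eq_0_iff[OF assms, of x] by simp
  then obtain X where X: "X ** P = mat 1"
    using matrix_left_invertible_ker[of P] by auto
  then have "P ** X = mat 1" using matrix_left_right_inverse by blast
  with X have "is_pinv P X" by (simp add: is_pinv_def transpose_mat)
  then show ?thesis using X pinv_eqI by metis
qed

section \<open>Square-integrable random vectors\<close>

text \<open>Measurability is included because integrability of the squared norm does not imply
  measurability of \<open>X\<close>.\<close>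

definition square_integrable :: "'a measure \<Rightarrow> ('a \<Rightarrow> 'b::euclidean_space) \<Rightarrow> bool" where
  "square_integrable M X \<longleftrightarrow> X \<in> borel_measurable M \<and> integrable M (\<lambda>\<omega>. (norm (X \<omega>))\<^sup>2)"

lemma square_integrable_measurable: "square_integrable M X \<Longrightarrow> X \<in> borel_measurable M"
  by (simp add: square_integrable_def)

lemma square_integrable_bound:
  assumes "integrable M g" "X \<in> borel_measurable M" "\<And>\<omega>. (norm (X \<omega>))\<^sup>2 \<le> g \<omega>"
  shows "square_integrable M X"
  unfolding square_integrable_def
proof
  show "integrable M (\<lambda>\<omega>. (norm (X \<omega>))\<^sup>2)"
    using assms(2) by (rule_tac Bochner_Integration.integrable_bound[OF assms(1)])
      (auto intro!: AE_I2 order_trans[OF assms(3)])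
qed (fact assms)

lemma square_integrable_inner:
  assumes "square_integrable M X" "square_integrable M Y"
  shows "integrable M (\<lambda>\<omega>. X \<omega> \<bullet> Y \<omega>)"
proof (rule Bochner_Integration.integrable_bound)
  show "integrable M (\<lambda>\<omega>. (norm (X \<omega>))\<^sup>2 + (norm (Y \<omega>))\<^sup>2)"
    using assms by (auto simp: square_integrable_def)
  show "(\<lambda>\<omega>. X \<omega> \<bullet> Y \<omega>) \<in> borel_measurable M"
    using assms by (auto simp: square_integrable_def)
  have "\<bar>x \<bullet> y\<bar> \<le> (norm x)\<^sup>2 + (norm y)\<^sup>2" for x y :: 'b
  proof -
    have "\<bar>x \<bullet> y\<bar> \<le> norm x * norm y" by (rule Cauchy_Schwarz_ineq2)
    also have "\<dots> \<le> (norm x)\<^sup>2 + (norm y)\<^sup>2"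
      using sum_squares_bound[of "norm x" "norm y"] mult_nonneg_nonneg[OF norm_ge_zero norm_ge_zero, of x y]
      unfolding mult.assoc by linarith
    finally show ?thesis .
  qed
  then show "AE \<omega> in M. norm (X \<omega> \<bullet> Y \<omega>) \<le> norm ((norm (X \<omega>))\<^sup>2 + (norm (Y \<omega>))\<^sup>2)"
    by (intro AE_I2) (simp add: abs_of_nonneg)
qed

lemma square_integrable_mult:
  fixes X Y :: "'a \<Rightarrow> real"
  shows "square_integrable M X \<Longrightarrow> square_integrable M Y \<Longrightarrow> integrable M (\<lambda>\<omega>. X \<omega> * Y \<omega>)"
  using square_integrable_inner[of M X Y] by (simp add: inner_real_def)

lemma square_integrable_bounded_linear:
  assumes "square_integrable M X" "bounded_linear f"
  shows "square_integrable M (\<lambda>\<omega>. f (X \<omega>))"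
proof -
  obtain C where C: "\<And>x. norm (f x) \<le> norm x * C"
    using bounded_linear.bounded[OF assms(2)] by blast
  show ?thesis
  proof (rule square_integrable_bound)
    show "integrable M (\<lambda>\<omega>. C\<^sup>2 * (norm (X \<omega>))\<^sup>2)"
      using assms(1) by (auto simp: square_integrable_def)
    have "f \<in> borel_measurable borel"
      using assms(2) by (intro borel_measurable_continuous_onI linear_continuous_on)
    then show "(\<lambda>\<omega>. f (X \<omega>)) \<in> borel_measurable M"
      using measurable_compose[OF square_integrable_measurable[OF assms(1)]] by blast
    show "(norm (f (X \<omega>)))\<^sup>2 \<le> C\<^sup>2 * (norm (X \<omega>))\<^sup>2" for \<omega>
      using power_mono[OF C, of "X \<omega>" 2] by (simp add: power_mult_distrib mult.commute)
  qed
qed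

lemma square_integrable_matrix_vector_mult:
  fixes W :: "real^'n^'m"
  shows "square_integrable M X \<Longrightarrow> square_integrable M (\<lambda>\<omega>. W *v X \<omega>)"
  by (rule square_integrable_bounded_linear) auto

lemma square_integrable_inner_left:
  "square_integrable M X \<Longrightarrow> square_integrable M (\<lambda>\<omega>. a \<bullet> X \<omega>)"
  by (rule square_integrable_bounded_linear) (auto intro: bounded_linear_inner_right)

lemma square_integrable_add:
  assumes "square_integrable M X" "square_integrable M Y"
  shows "square_integrable M (\<lambda>\<omega>. X \<omega> + Y \<omega>)"
proof (rule square_integrable_bound)
  show "integrable M (\<lambda>\<omega>. 2 * (norm (X \<omega>))\<^sup>2 + 2 * (norm (Y \<omega>))\<^sup>2)"
    using assms by (auto simp: square_integrable_def)
  show "(\<lambda>\<omega>. X \<omega> + Y \<omega>) \<in> borel_measurable M"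
    using assms by (auto simp: square_integrable_def)
  have "(norm (x + y))\<^sup>2 \<le> 2 * (norm x)\<^sup>2 + 2 * (norm y)\<^sup>2" for x y :: 'b
  proof -
    have "(norm (x + y))\<^sup>2 \<le> (norm x + norm y)\<^sup>2"
      by (intro power_mono norm_triangle_ineq) auto
    also have "\<dots> \<le> 2 * (norm x)\<^sup>2 + 2 * (norm y)\<^sup>2"
      using sum_squares_bound[of "norm x" "norm y"] by (simp add: power2_sum)
    finally show ?thesis .
  qed
  then show "(norm (X \<omega> + Y \<omega>))\<^sup>2 \<le> 2 * (norm (X \<omega>))\<^sup>2 + 2 * (norm (Y \<omega>))\<^sup>2" for \<omega> .
qed

lemma square_integrable_diff:
  assumes "square_integrable M X" "square_integrable M Y"
  shows "square_integrable M (\<lambda>\<omega>. X \<omega> - Y \<omega>)"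
  using square_integrable_add[OF assms(1)
      square_integrable_bounded_linear[OF assms(2) bounded_linear_minus[OF bounded_linear_ident]]]
  by simp

lemma square_integrable_zero: "square_integrable M (\<lambda>_. 0)"
  by (simp add: square_integrable_def)

lemma square_integrable_sum:
  assumes "\<And>i. i \<in> I \<Longrightarrow> square_integrable M (X i)"
  shows "square_integrable M (\<lambda>\<omega>. \<Sum>i\<in>I. X i \<omega>)"
proof (cases "finite I")
  case True
  then show ?thesis using assms
    by (induction I) (auto simp: square_integrable_zero intro!: square_integrable_add)
qed (simp add: square_integrable_zero)

text \<open>The Gaussian assumption speaks about scalar functionals only; recombining the
  coordinates yields the vector.\<close>

lemma square_integrable_vec:
  fixes X :: "'a \<Rightarrow> real^'d"
  assumes "\<And>a. square_integrable M (\<lambda>\<omega>. a \<bullet> X \<omega>)"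
  shows "square_integrable M X"
proof -
  have "square_integrable M (\<lambda>\<omega>. \<Sum>i\<in>UNIV. (axis i 1 \<bullet> X \<omega>) *\<^sub>R (axis i 1 :: real^'d))"
    by (intro square_integrable_sum square_integrable_bounded_linear[OF assms]
        bounded_linear_scaleR_left)
  moreover have "(\<Sum>i\<in>UNIV. (axis i 1 \<bullet> x) *\<^sub>R (axis i 1 :: real^'d)) = x" for x :: "real^'d"
    using basis_expansion[of x] by (simp add: inner_axis' scalar_mult_eq_scaleR)
  ultimately show ?thesis by simp
qed

text \<open>This says that the matrix E[X Y^T] vanishes, tested by scalar functionals so that
  \<open>X\<close> and \<open>Y\<close> may have different dimensions. Nothing is centred
  here.\<close>

definition orthogonal_rv :: "'a measure \<Rightarrow> ('a \<Rightarrow> real^'m) \<Rightarrow> ('a \<Rightarrow> real^'n) \<Rightarrow> bool" where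
  "orthogonal_rv M X Y \<longleftrightarrow> (\<forall>a b. (\<integral>\<omega>. (a \<bullet> X \<omega>) * (b \<bullet> Y \<omega>) \<partial>M) = 0)"

lemma orthogonal_rvD: "orthogonal_rv M X Y \<Longrightarrow> (\<integral>\<omega>. (a \<bullet> X \<omega>) * (b \<bullet> Y \<omega>) \<partial>M) = 0"
  by (simp add: orthogonal_rv_def)

lemma orthogonal_rv_sym: "orthogonal_rv M X Y \<Longrightarrow> orthogonal_rv M Y X"
  by (simp add: orthogonal_rv_def mult.commute)

lemma orthogonal_rv_matrix_vector_mult:
  fixes W :: "real^'n^'m"
  shows "orthogonal_rv M X Y \<Longrightarrow> orthogonal_rv M (\<lambda>\<omega>. W *v X \<omega>) Y"
  unfolding orthogonal_rv_def by (simp add: inner_matrix_vector_mult_left)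

lemma integrable_inner_mult_inner:
  fixes X :: "'a \<Rightarrow> real^'m" and Y :: "'a \<Rightarrow> real^'n"
  assumes "square_integrable M X" "square_integrable M Y"
  shows "integrable M (\<lambda>\<omega>. (a \<bullet> X \<omega>) * (b \<bullet> Y \<omega>))"
  using assms by (intro square_integrable_mult square_integrable_inner_left)

lemma orthogonal_rv_add:
  assumes "square_integrable M X" "square_integrable M Y" "square_integrable M Z"
    "orthogonal_rv M X Z" "orthogonal_rv M Y Z"
  shows "orthogonal_rv M (\<lambda>\<omega>. X \<omega> + Y \<omega>) Z"
  using assms unfolding orthogonal_rv_def
  by (simp add: inner_add_right distrib_right integrable_inner_mult_inner)

lemma orthogonal_rv_diff:
  assumes "square_integrable M X" "square_integrable M Y" "square_integrable M Z"
    "orthogonal_rv M X Z" "orthogonal_rv M Y Z"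
  shows "orthogonal_rv M (\<lambda>\<omega>. X \<omega> - Y \<omega>) Z"
  using assms unfolding orthogonal_rv_def
  by (simp add: inner_diff_right left_diff_distrib integrable_inner_mult_inner)

lemma orthogonal_rv_sum:
  assumes "\<And>i. i \<in> I \<Longrightarrow> square_integrable M (X i)" "square_integrable M Z"
    "\<And>i. i \<in> I \<Longrightarrow> orthogonal_rv M (X i) Z"
  shows "orthogonal_rv M (\<lambda>\<omega>. \<Sum>i\<in>I. X i \<omega>) Z"
  unfolding orthogonal_rv_def
  by (auto simp: inner_sum_right sum_distrib_right assms(3) orthogonal_rvD
      integrable_inner_mult_inner assms(1,2))

lemma orthogonal_rv_const:
  assumes "integrable M Z" "integral\<^sup>L M Z = 0"
  shows "orthogonal_rv M (\<lambda>_. c) Z"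
  using assms unfolding orthogonal_rv_def by simp

text \<open>The bilinear form is a finite sum of products of a coordinate of \<open>X\<close> with a
  functional of \<open>Y\<close>, and each product has expectation zero.\<close>

lemma integral_orthogonal_rv_quadratic:
  fixes W :: "real^'n^'m"
  assumes "square_integrable M X" "square_integrable M Y" "orthogonal_rv M X Y"
  shows "(\<integral>\<omega>. X \<omega> \<bullet> (W *v Y \<omega>) \<partial>M) = 0"
proof -
  have "x \<bullet> (W *v y) = (\<Sum>i\<in>UNIV. (axis i 1 \<bullet> x) * ((transpose W *v axis i 1) \<bullet> y))" for x y
    unfolding inner_matrix_vector_mult_left[symmetric]
    by (simp add: inner_axis') (simp add: inner_vec_def)
  then show ?thesis
    using assms by (simp add: integrable_inner_mult_inner orthogonal_rvD)
qed

text \<open>The component type is general, so that the rule applies to a matrix-valued function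
  twice: first to its rows, then to their entries.\<close>

lemma integrable_vec:
  fixes X :: "'a \<Rightarrow> 'b::euclidean_space^'d"
  assumes "\<And>i. integrable M (\<lambda>\<omega>. X \<omega> $ i)"
  shows "integrable M X"
proof -
  have "bounded_linear (axis i :: 'b \<Rightarrow> 'b^'d)" for i
    unfolding linear_conv_bounded_linear[symmetric]
    by (rule linearI) (simp_all add: axis_def vec_eq_iff)
  then have "integrable M (\<lambda>\<omega>. \<Sum>i\<in>UNIV. axis i (X \<omega> $ i))"
    using integrable_bounded_linear[OF _ assms] by (intro Bochner_Integration.integrable_sum) blast
  moreover have "(\<Sum>i\<in>UNIV. axis i (x $ i)) = x" for x :: "'b^'d"
    by (simp add: vec_eq_iff axis_def if_distrib cong: if_cong)
  ultimately show ?thesis by simp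
qed

section \<open>Means, covariances and Pythagoras for square-integrable vectors\<close>

context prob_space
begin

lemma square_integrable_const: "square_integrable M (\<lambda>_. c)"
  by (simp add: square_integrable_def)

lemma square_integrable_imp_integrable:
  assumes "square_integrable M X"
  shows "integrable M X"
proof -
  have "norm x \<le> 1 + (norm x)\<^sup>2" for x :: 'b
    using sum_squares_bound[of 1 "norm x"] norm_ge_zero[of x] by (simp, linarith)
  then show ?thesis
    using assms by (rule_tac Bochner_Integration.integrable_bound[of M "\<lambda>\<omega>. 1 + (norm (X \<omega>))\<^sup>2"])
      (auto simp: square_integrable_def)
qed

lemma square_integrable_centered:
  "square_integrable M X \<Longrightarrow> square_integrable M (\<lambda>\<omega>. X \<omega> - mean M X)"
  by (intro square_integrable_diff square_integrable_const)

lemma integral_centered: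
  "square_integrable M X \<Longrightarrow> (\<integral>\<omega>. X \<omega> - mean M X \<partial>M) = 0"
  by (simp add: square_integrable_imp_integrable prob_space)

text \<open>For fixed \<open>a\<close> and \<open>b\<close> the map from a matrix \<open>P\<close>
  to its bilinear form is bounded and linear, hence commutes with the matrix-valued integral.
  Covariance matrices are handled through this identity from here on.\<close>

lemma cross_cov_inner:
  fixes X :: "'a \<Rightarrow> real^'m" and Y :: "'a \<Rightarrow> real^'n"
  assumes "square_integrable M X" "square_integrable M Y"
  shows "a \<bullet> (cross_cov M X Y *v b)
       = (\<integral>\<omega>. (a \<bullet> (X \<omega> - mean M X)) * (b \<bullet> (Y \<omega> - mean M Y)) \<partial>M)"
proof -
  define Z :: "'a \<Rightarrow> real^'n^'m" where
    "Z = (\<lambda>\<omega>. \<chi> i j. (X \<omega> - mean M X) $ i * (Y \<omega> - mean M Y) $ j)"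
  have "integrable M (\<lambda>\<omega>. (X \<omega> - mean M X) $ i * (Y \<omega> - mean M Y) $ j)" for i j
    using integrable_inner_mult_inner[OF square_integrable_centered square_integrable_centered,
        OF assms, of "axis i 1" "axis j 1"]
    by (simp add: inner_axis')
  then have Z: "integrable M Z"
    unfolding Z_def by (intro integrable_vec) simp
  have "bounded_linear (\<lambda>P :: real^'n^'m. a \<bullet> (P *v b))"
    unfolding linear_conv_bounded_linear[symmetric]
    by (rule linearI)
      (simp_all add: matrix_vector_mult_add_rdistrib inner_add_right scaleR_matrix_vector_assoc[symmetric])
  then have "a \<bullet> (integral\<^sup>L M Z *v b) = (\<integral>\<omega>. a \<bullet> (Z \<omega> *v b) \<partial>M)"
    using Z by (rule integral_bounded_linear[symmetric])
  also have "(\<lambda>\<omega>. a \<bullet> (Z \<omega> *v b))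
      = (\<lambda>\<omega>. (a \<bullet> (X \<omega> - mean M X)) * (b \<bullet> (Y \<omega> - mean M Y)))"
    by (rule ext, subst mult.commute, simp add: Z_def inner_vec_def matrix_vector_mult_def
        sum_product sum_distrib_left mult_ac, rule sum.swap)
  finally show ?thesis by (simp add: cross_cov_def Z_def)
qed

lemma transpose_cov: "transpose (cov M X) = cov M X"
  if "square_integrable M X" for X :: "'a \<Rightarrow> real^'d"
proof -
  have "axis i 1 \<bullet> (cov M X *v axis j 1) = axis j 1 \<bullet> (cov M X *v axis i 1)" for i j
    by (simp add: cross_cov_inner that mult.commute)
  then show ?thesis
    by (simp add: vec_eq_iff transpose_def inner_axis' matrix_vector_mult_basis column_def)
qed

lemma psd_cov:
  fixes X :: "'a \<Rightarrow> real^'d"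
  assumes "square_integrable M X"
  shows "psd (cov M X)"
  using assms by (simp add: psd_def transpose_cov cross_cov_inner)

lemma cov_inner:
  fixes X :: "'a \<Rightarrow> real^'d"
  assumes "square_integrable M X"
  shows "a \<bullet> (cov M X *v a) = (\<integral>\<omega>. (a \<bullet> (X \<omega> - mean M X))\<^sup>2 \<partial>M)"
  using assms by (simp add: cross_cov_inner power2_eq_square)

text \<open>The quadratic form of a covariance in direction \<open>a\<close> is the variance of that
  functional, so the Loewner order can be checked one direction at a time.\<close>

lemma loewner_le_cov:
  fixes X Y :: "'a \<Rightarrow> real^'d"
  assumes "square_integrable M X" "square_integrable M Y"
    "\<And>a. (\<integral>\<omega>. (a \<bullet> (X \<omega> - mean M X))\<^sup>2 \<partial>M) \<le> (\<integral>\<omega>. (a \<bullet> (Y \<omega> - mean M Y))\<^sup>2 \<partial>M)"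
  shows "loewner_le (cov M X) (cov M Y)"
proof -
  have "transpose (cov M Y - cov M X) = transpose (cov M Y) - transpose (cov M X)"
    by (simp add: transpose_def vec_eq_iff)
  then show ?thesis
    using assms
    by (simp add: loewner_le_def psd_def transpose_cov matrix_vector_mult_diff_rdistrib
        inner_diff_right cov_inner)
qed

text \<open>Writing \<open>Q\<close> as a sum of squares reduces the claim to the assumed inequality
  for each of finitely many directions.\<close>

lemma integral_quadratic_mono:
  fixes X Y :: "'a \<Rightarrow> real^'d"
  assumes "psd Q" "square_integrable M X" "square_integrable M Y"
    "\<And>a. (\<integral>\<omega>. (a \<bullet> X \<omega>)\<^sup>2 \<partial>M) \<le> (\<integral>\<omega>. (a \<bullet> Y \<omega>)\<^sup>2 \<partial>M)"
  shows "(\<integral>\<omega>. X \<omega> \<bullet> (Q *v X \<omega>) \<partial>M) \<le> (\<integral>\<omega>. Y \<omega> \<bullet> (Q *v Y \<omega>) \<partial>M)"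
proof -
  from psd_sum_of_squares[OF assms(1)]
  obtain q :: "'d \<Rightarrow> real^'d" where q: "\<forall>x. x \<bullet> (Q *v x) = (\<Sum>i\<in>UNIV. (q i \<bullet> x)\<^sup>2)" ..
  have "integrable M (\<lambda>\<omega>. (q i \<bullet> X \<omega>)\<^sup>2)" "integrable M (\<lambda>\<omega>. (q i \<bullet> Y \<omega>)\<^sup>2)" for i
    using integrable_inner_mult_inner[OF assms(2,2)] integrable_inner_mult_inner[OF assms(3,3)]
    by (simp_all add: power2_eq_square)
  then show ?thesis
    unfolding q[rule_format] using assms(4) by (simp add: sum_mono)
qed

text \<open>Symmetry of \<open>Q\<close> merges the two mixed terms into twice one bilinear term,
  whose expectation is zero by orthogonality.\<close>

lemma integral_quadratic_orthogonal_add: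
  fixes X Y :: "'a \<Rightarrow> real^'d"
  assumes "transpose Q = Q" "square_integrable M X" "square_integrable M Y" "orthogonal_rv M X Y"
  shows "(\<integral>\<omega>. (X \<omega> + Y \<omega>) \<bullet> (Q *v (X \<omega> + Y \<omega>)) \<partial>M)
       = (\<integral>\<omega>. X \<omega> \<bullet> (Q *v X \<omega>) \<partial>M) + (\<integral>\<omega>. Y \<omega> \<bullet> (Q *v Y \<omega>) \<partial>M)"
proof -
  have eq: "(x + y) \<bullet> (Q *v (x + y)) = x \<bullet> (Q *v x) + y \<bullet> (Q *v y) + 2 * (x \<bullet> (Q *v y))" for x y
    using inner_symmetric_matrix[OF assms(1), of x y]
    by (simp add: matrix_vector_right_distrib inner_add_left inner_add_right)
  show ?thesis
    unfolding eq using assms(2-)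
    by (simp add: square_integrable_inner square_integrable_matrix_vector_mult
        integral_orthogonal_rv_quadratic)
qed

lemma integral_square_inner_orthogonal_add:
  fixes X Y :: "'a \<Rightarrow> real^'d"
  assumes "square_integrable M X" "square_integrable M Y" "orthogonal_rv M X Y"
  shows "(\<integral>\<omega>. (a \<bullet> (X \<omega> + Y \<omega>))\<^sup>2 \<partial>M) = (\<integral>\<omega>. (a \<bullet> X \<omega>)\<^sup>2 \<partial>M) + (\<integral>\<omega>. (a \<bullet> Y \<omega>)\<^sup>2 \<partial>M)"
proof -
  have eq: "(a \<bullet> (x + y))\<^sup>2 = (a \<bullet> x) * (a \<bullet> x) + (a \<bullet> y) * (a \<bullet> y) + 2 * ((a \<bullet> x) * (a \<bullet> y))" for x y
    by (simp add: inner_add_right power2_eq_square algebra_simps)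
  show ?thesis
    unfolding eq using assms
    by (simp add: integrable_inner_mult_inner orthogonal_rvD power2_eq_square)
qed

text \<open>Pythagoras applied to the centred vector and its constant mean.\<close>

lemma integral_quadratic_mean:
  fixes X :: "'a \<Rightarrow> real^'d"
  assumes "transpose Q = Q" "square_integrable M X"
  shows "(\<integral>\<omega>. X \<omega> \<bullet> (Q *v X \<omega>) \<partial>M)
       = (\<integral>\<omega>. (X \<omega> - mean M X) \<bullet> (Q *v (X \<omega> - mean M X)) \<partial>M) + mean M X \<bullet> (Q *v mean M X)"
proof -
  have "orthogonal_rv M (\<lambda>_. mean M X) (\<lambda>\<omega>. X \<omega> - mean M X)"
    using square_integrable_imp_integrable[OF square_integrable_centered[OF assms(2)]]
      integral_centered[OF assms(2)] by (rule orthogonal_rv_const)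
  then have "orthogonal_rv M (\<lambda>\<omega>. X \<omega> - mean M X) (\<lambda>_. mean M X)"
    by (rule orthogonal_rv_sym)
  from integral_quadratic_orthogonal_add[OF assms(1) square_integrable_centered[OF assms(2)]
      square_integrable_const this]
  show ?thesis by (simp add: prob_space)
qed

end

section \<open>Second moments of the noise model\<close>

context prob_space
begin

lemma gaussian_square_integrable_inner:
  assumes "gaussian M X \<mu> P"
  shows "square_integrable M (\<lambda>\<omega>. a \<bullet> X \<omega>)"
proof (cases "a \<bullet> (P *v a) = 0")
  case True
  then have "AE \<omega> in M. a \<bullet> X \<omega> = a \<bullet> \<mu>"
    using assms unfolding gaussian_def by metis
  then have "integrable M (\<lambda>\<omega>. (norm (a \<bullet> X \<omega>))\<^sup>2) \<longleftrightarrow> integrable M (\<lambda>\<omega>. (norm (a \<bullet> \<mu>))\<^sup>2)"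
    using assms by (intro integrable_cong_AE) (auto simp: gaussian_def)
  moreover have "(\<lambda>\<omega>. a \<bullet> X \<omega>) \<in> borel_measurable M"
    using assms unfolding gaussian_def by (intro borel_measurable_inner) auto
  ultimately show ?thesis by (simp add: square_integrable_def)
next
  case False
  let ?m = "a \<bullet> \<mu>" and ?s = "sqrt (a \<bullet> (P *v a))"
  have D: "distributed M lborel (\<lambda>\<omega>. a \<bullet> X \<omega>) (normal_density ?m ?s)"
    using assms False unfolding gaussian_def by metis
  have "0 < a \<bullet> (P *v a)"
    using assms False by (auto simp: gaussian_def psd_def less_le)
  then have s: "0 < ?s" by simp
  \<comment> \<open>The normal moment of order 2 is taken about the mean \<open>?m\<close>; the
    constant is added back afterwards.\<close>
  have "integrable M (\<lambda>\<omega>. (a \<bullet> X \<omega> - ?m)\<^sup>2)"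
    using distributed_integrable[OF D, of "\<lambda>x. (x - ?m)\<^sup>2"] integrable_normal_moment[OF s, of ?m 2]
    by simp
  then have "square_integrable M (\<lambda>\<omega>. a \<bullet> X \<omega> - ?m)"
    using assms by (auto simp: square_integrable_def gaussian_def
        intro!: borel_measurable_diff borel_measurable_inner)
  from square_integrable_add[OF this square_integrable_const[of ?m]] show ?thesis by simp
qed

lemma gaussian_square_integrable:
  "gaussian M X \<mu> P \<Longrightarrow> square_integrable M X"
  by (rule square_integrable_vec) (rule gaussian_square_integrable_inner)

lemma gaussian_mean_inner:
  assumes "gaussian M X \<mu> P"
  shows "(\<integral>\<omega>. a \<bullet> X \<omega> \<partial>M) = a \<bullet> \<mu>"
proof (cases "a \<bullet> (P *v a) = 0")
  case True
  then have "AE \<omega> in M. a \<bullet> X \<omega> = a \<bullet> \<mu>"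
    using assms unfolding gaussian_def by metis
  then have "(\<integral>\<omega>. a \<bullet> X \<omega> \<partial>M) = (\<integral>\<omega>. a \<bullet> \<mu> \<partial>M)"
    using assms by (intro integral_cong_AE) (auto simp: gaussian_def)
  then show ?thesis by (simp add: prob_space)
next
  case False
  have "distributed M lborel (\<lambda>\<omega>. a \<bullet> X \<omega>) (normal_density (a \<bullet> \<mu>) (sqrt (a \<bullet> (P *v a))))"
    using assms False unfolding gaussian_def by metis
  moreover have "0 < a \<bullet> (P *v a)"
    using assms False by (auto simp: gaussian_def psd_def less_le)
  ultimately show ?thesis
    by (intro normal_distributed_expectation) auto
qed

lemma gaussian_mean:
  fixes X :: "'a \<Rightarrow> real^'d"
  assumes "gaussian M X \<mu> P"
  shows "mean M X = \<mu>"
proof -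
  have "a \<bullet> mean M X = a \<bullet> \<mu>" for a
    using gaussian_mean_inner[OF assms, of a]
      square_integrable_imp_integrable[OF gaussian_square_integrable[OF assms]] by simp
  then show ?thesis by (metis vector_eq_rdot inner_commute)
qed

lemma gaussian_variance_inner:
  fixes X :: "'a \<Rightarrow> real^'d"
  assumes "gaussian M X \<mu> P"
  shows "(\<integral>\<omega>. (a \<bullet> (X \<omega> - mean M X))\<^sup>2 \<partial>M) = a \<bullet> (P *v a)"
proof (cases "a \<bullet> (P *v a) = 0")
  case True
  then have "AE \<omega> in M. a \<bullet> X \<omega> = a \<bullet> \<mu>"
    using assms unfolding gaussian_def by metis
  then have "AE \<omega> in M. (a \<bullet> (X \<omega> - \<mu>))\<^sup>2 = 0"
    by (auto simp: inner_diff_right)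
  then have "(\<integral>\<omega>. (a \<bullet> (X \<omega> - \<mu>))\<^sup>2 \<partial>M) = (\<integral>\<omega>. 0 \<partial>M)"
    using assms by (intro integral_cong_AE) (auto simp: gaussian_def)
  then show ?thesis using True by (simp add: gaussian_mean[OF assms])
next
  case False
  have D: "distributed M lborel (\<lambda>\<omega>. a \<bullet> X \<omega>) (normal_density (a \<bullet> \<mu>) (sqrt (a \<bullet> (P *v a))))"
    using assms False unfolding gaussian_def by metis
  have s: "0 < a \<bullet> (P *v a)"
    using assms False by (auto simp: gaussian_def psd_def less_le)
  show ?thesis
    using normal_distributed_variance[OF _ D] s
    by (simp add: gaussian_mean_inner[OF assms] gaussian_mean[OF assms] inner_diff_right)
qed

lemma indep_set_mono: "indep_set U V \<Longrightarrow> U' \<subseteq> U \<Longrightarrow> V' \<subseteq> V \<Longrightarrow> indep_set U' V'"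
  unfolding indep_sets2_eq by (simp add: subset_iff)

text \<open>Independence passes to the scalar functionals, so the expectation of their product
  factors, and the factor coming from \<open>Y\<close> is zero. Stating independence for generated
  sigma-algebras lets \<open>X\<close> and \<open>Y\<close> have different dimensions.\<close>

lemma orthogonal_rv_indep:
  fixes X :: "'a \<Rightarrow> real^'m" and Y :: "'a \<Rightarrow> real^'n"
  assumes "square_integrable M X" "square_integrable M Y" "integral\<^sup>L M Y = 0"
    "indep_set (sigma_sets (space M) {X -` A \<inter> space M | A. A \<in> sets borel})
      (sigma_sets (space M) {Y -` A \<inter> space M | A. A \<in> sets borel})"
  shows "orthogonal_rv M X Y"
  unfolding orthogonal_rv_def
proof (intro allI)
  fix a :: "real^'m" and b :: "real^'n"
  let ?U = "\<lambda>\<omega>. a \<bullet> X \<omega>" and ?V = "\<lambda>\<omega>. b \<bullet> Y \<omega>"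
  have [measurable]: "X \<in> borel_measurable M" "Y \<in> borel_measurable M"
    using assms by (simp_all add: square_integrable_def)
  have "indep_var borel ?U borel ?V"
    unfolding indep_var_eq
  proof (intro conjI)
    \<comment> \<open>A linear functional is Borel, so it generates a smaller sigma-algebra than the
      vector itself.\<close>
    have sub: "sigma_sets (space M) {(\<lambda>\<omega>. c \<bullet> Z \<omega>) -` A \<inter> space M |A. A \<in> sets borel}
        \<subseteq> sigma_sets (space M) {Z -` A \<inter> space M |A. A \<in> sets borel}"
      for c :: "real^'d" and Z
    proof (rule sigma_sets_mono, safe)
      fix A :: "real set" assume A: "A \<in> sets borel"
      have "(\<lambda>x. c \<bullet> x) \<in> borel_measurable borel" by measurable
      from measurable_sets[OF this A]
      have "(\<lambda>x. c \<bullet> x) -` A \<inter> space borel \<in> sets borel" .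
      moreover have "(\<lambda>\<omega>. c \<bullet> Z \<omega>) -` A = Z -` ((\<lambda>x. c \<bullet> x) -` A \<inter> space borel)"
        by auto
      ultimately show "(\<lambda>\<omega>. c \<bullet> Z \<omega>) -` A \<inter> space M
          \<in> sigma_sets (space M) {Z -` A \<inter> space M |A. A \<in> sets borel}"
        by blast
    qed
    show "indep_set (sigma_sets (space M) {?U -` A \<inter> space M |A. A \<in> sets borel})
        (sigma_sets (space M) {?V -` A \<inter> space M |A. A \<in> sets borel})"
      by (rule indep_set_mono[OF assms(4)]) (rule sub)+
  qed measurable
  moreover have "integrable M ?U" "integrable M ?V"
    by (intro square_integrable_imp_integrable square_integrable_inner_left assms)+
  ultimately have "(\<integral>\<omega>. ?U \<omega> * ?V \<omega> \<partial>M) = (\<integral>\<omega>. ?U \<omega> \<partial>M) * (\<integral>\<omega>. ?V \<omega> \<partial>M)"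
    by (rule indep_var_lebesgue_integral)
  also have "(\<integral>\<omega>. ?V \<omega> \<partial>M) = 0"
    using assms by (simp add: square_integrable_imp_integrable)
  finally show "(\<integral>\<omega>. ?U \<omega> * ?V \<omega> \<partial>M) = 0" by simp
qed

end

text \<open>These second-order facts pass from the noise model to the locale
  \<open>linear_system\<close>.\<close>

lemma noise_model_moments:
  fixes x0 :: "'a \<Rightarrow> real^'n" and w :: "nat \<Rightarrow> 'a \<Rightarrow> real^'l"
  assumes "noise_model M N \<mu>0 P0 x0 w"
  shows "prob_space M" "square_integrable M x0"
    and "(\<integral>\<omega>. (a \<bullet> (x0 \<omega> - mean M x0))\<^sup>2 \<partial>M) = a \<bullet> (P0 *v a)"
    and "k < N \<Longrightarrow> square_integrable M (w k)"
    and "k < N \<Longrightarrow> mean M (w k) = 0"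
    and "k < N \<Longrightarrow> (\<integral>\<omega>. (b \<bullet> w k \<omega>)\<^sup>2 \<partial>M) = b \<bullet> b"
    and "k < N \<Longrightarrow> orthogonal_rv M x0 (w k)"
    and "i < k \<Longrightarrow> k < N \<Longrightarrow> orthogonal_rv M (w i) (w k)"
proof -
  show "prob_space M" using assms by (simp add: noise_model_def)
  then interpret prob_space M .
  have x0: "gaussian M x0 \<mu>0 P0" and w: "\<And>k. k < N \<Longrightarrow> gaussian M (w k) 0 (mat 1)"
    using assms by (auto simp: noise_model_def)
  show sx: "square_integrable M x0" and "(\<integral>\<omega>. (a \<bullet> (x0 \<omega> - mean M x0))\<^sup>2 \<partial>M) = a \<bullet> (P0 *v a)"
    using gaussian_square_integrable[OF x0] gaussian_variance_inner[OF x0] by simp_all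
  show sw: "square_integrable M (w k)" and mw: "mean M (w k) = 0"
    and "(\<integral>\<omega>. (b \<bullet> w k \<omega>)\<^sup>2 \<partial>M) = b \<bullet> b" if "k < N" for k
    using gaussian_square_integrable[OF w] gaussian_variance_inner[OF w, of k b]
      gaussian_mean[OF w] that by simp_all
  show "orthogonal_rv M x0 (w k)" if k: "k < N"
  proof (rule orthogonal_rv_indep[OF sx sw[OF k] mw[OF k]])
    let ?W = "\<lambda>\<omega>. \<lambda>k\<in>{..<N}. w k \<omega>"
    have ind: "indep_set (sets (vimage_algebra (space M) x0 borel))
        (sets (vimage_algebra (space M) ?W (PiM {..<N} (\<lambda>_. borel))))"
      using assms by (simp add: noise_model_def)
    \<comment> \<open>Each \<open>w k\<close> is a coordinate of the joint noise vector, so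
      independence of \<open>x0\<close> from the whole sequence restricts to it.\<close>
    have "sigma_sets (space M) {w k -` A \<inter> space M | A. A \<in> sets borel}
        \<subseteq> sets (vimage_algebra (space M) ?W (PiM {..<N} (\<lambda>_. borel)))"
      unfolding sets_vimage_algebra
    proof (rule sigma_sets_mono, safe)
      fix A :: "(real^'l) set" assume A: "A \<in> sets borel"
      let ?A = "(\<lambda>f. f k) -` A \<inter> space (PiM {..<N} (\<lambda>_. borel))"
      have "?A \<in> sets (PiM {..<N} (\<lambda>_. borel))"
        using A k by (intro measurable_sets[OF measurable_component_singleton]) auto
      moreover have "w k -` A \<inter> space M = ?W -` ?A \<inter> space M"
        using k by (auto simp: space_PiM)
      ultimately show "w k -` A \<inter> space M
          \<in> sigma_sets (space M) {?W -` A \<inter> space M |A. A \<in> sets (PiM {..<N} (\<lambda>_. borel))}"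
        by blast
    qed
    then show "indep_set (sigma_sets (space M) {x0 -` A \<inter> space M |A. A \<in> sets borel})
        (sigma_sets (space M) {w k -` A \<inter> space M |A. A \<in> sets borel})"
      by (rule indep_set_mono[OF ind, rotated]) (simp add: sets_vimage_algebra)
  qed
  show "orthogonal_rv M (w i) (w k)" if i: "i < k" and k: "k < N"
  proof (rule orthogonal_rv_indep[OF sw sw mw])
    have vars: "indep_vars (\<lambda>_. borel) w {..<N}"
      using assms by (simp add: noise_model_def)
    let ?F = "\<lambda>i. {w i -` A \<inter> space M | A. A \<in> sets borel}"
    have F: "indep_sets (\<lambda>i. sigma_sets (space M) (?F i)) {..<N}"
      using vars by (simp add: indep_vars_def)
    show "indep_set (sigma_sets (space M) (?F i)) (sigma_sets (space M) (?F k))"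
    proof (rule indep_setI)
      fix U V
      assume "U \<in> sigma_sets (space M) (?F i)" "V \<in> sigma_sets (space M) (?F k)"
      then show "prob (U \<inter> V) = prob U * prob V"
        \<comment> \<open>The event family is \<open>U\<close> at index \<open>i\<close> and
          \<open>V\<close> at index \<open>k\<close>; since \<open>i < k\<close> the product over
          \<open>{i, k}\<close> has exactly these two factors.\<close>
        using indep_setsD[OF F, of "{i, k}" "\<lambda>j. if j = i then U else V"] i k
        by (auto simp: Int_commute)
    qed (use F i k in \<open>auto simp: indep_sets_def\<close>)
  qed (use i k in auto)
qed

section \<open>Comparison with the Markov policy\<close>

text \<open>The stochastic model reduced to second moments: means, variances and orthogonality of
  the initial state and the noises, plus the definiteness of \<open>P0\<close> and of the noise
  covariances.\<close>

locale linear_system = prob_space M for M :: "'a measure" +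
  fixes N :: nat
    and A :: "nat \<Rightarrow> real^'n^'n" and B :: "nat \<Rightarrow> real^'m^'n" and G :: "nat \<Rightarrow> real^'l^'n"
    and P0 :: "real^'n^'n" and x0 :: "'a \<Rightarrow> real^'n" and w :: "nat \<Rightarrow> 'a \<Rightarrow> real^'l"
  assumes pd_P0: "pd P0"
    and pd_noise: "\<And>k. k < N \<Longrightarrow> pd (G k ** transpose (G k))"
    and square_integrable_initial: "square_integrable M x0"
    and initial_variance: "\<And>a. (\<integral>\<omega>. (a \<bullet> (x0 \<omega> - mean M x0))\<^sup>2 \<partial>M) = a \<bullet> (P0 *v a)"
    and square_integrable_noise: "\<And>k. k < N \<Longrightarrow> square_integrable M (w k)"
    and mean_noise: "\<And>k. k < N \<Longrightarrow> mean M (w k) = 0"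
    and noise_variance: "\<And>k b. k < N \<Longrightarrow> (\<integral>\<omega>. (b \<bullet> w k \<omega>)\<^sup>2 \<partial>M) = b \<bullet> b"
    and orthogonal_initial_noise: "\<And>k. k < N \<Longrightarrow> orthogonal_rv M x0 (w k)"
    and orthogonal_noise: "\<And>i k. i < k \<Longrightarrow> k < N \<Longrightarrow> orthogonal_rv M (w i) (w k)"
begin

abbreviation x where "x v K \<equiv> state M A B G x0 w v K"
abbreviation u where "u v K \<equiv> control M A B G x0 w v K"
abbreviation gain where "gain v K \<equiv> regression_gain M A B G x0 w v K"
text \<open>The gains stay those of the closed loop under \<open>K\<close>; they are not recomputed
  for the loop that this new policy generates.\<close>

abbreviation markov where "markov v K \<equiv> blkdiag_zero N (gain v K)"

section \<open>Centred closed-loop processes and their moments\<close>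

definition xc where "xc v K k = (\<lambda>\<omega>. x v K k \<omega> - mean M (x v K k))"
text \<open>Given directly by the history sum; \<open>centered_control\<close> identifies it with
  the centred control.\<close>

definition uc where "uc v K k = (\<lambda>\<omega>. \<Sum>i\<le>k. K k i *v xc v K i \<omega>)"
text \<open>The regression error of the control on the current state, called e in the
  overview.\<close>

definition resid where "resid v K k = (\<lambda>\<omega>. uc v K k \<omega> - gain v K k *v xc v K k \<omega>)"

lemma control_eq: "u v K k = (\<lambda>\<omega>. v k + uc v K k \<omega>)"
  by (simp add: control_def history_policy_def uc_def xc_def fun_eq_iff)

lemma state_Suc:
  "x v K (Suc k) = (\<lambda>\<omega>. A k *v x v K k \<omega> + B k *v u v K k \<omega> + G k *v w k \<omega>)"
  by (simp add: control_def)

text \<open>Strong induction, because the control at one step involves all states up to that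
  step.\<close>

lemma square_integrable_state: "k \<le> N \<Longrightarrow> square_integrable M (x v K k)"
proof (induction k rule: less_induct)
  case (less k)
  show ?case
  proof (cases k)
    case 0
    then show ?thesis by (simp add: square_integrable_initial)
  next
    case (Suc j)
    then have "square_integrable M (uc v K j)"
      using less unfolding uc_def xc_def
      by (intro square_integrable_sum square_integrable_matrix_vector_mult
          square_integrable_centered) auto
    then show ?thesis
      using less Suc unfolding Suc state_Suc control_eq
      by (intro square_integrable_add square_integrable_matrix_vector_mult
          square_integrable_const square_integrable_noise) auto
  qed
qed

lemma square_integrable_xc: "k \<le> N \<Longrightarrow> square_integrable M (xc v K k)"
  unfolding xc_def by (intro square_integrable_centered square_integrable_state)

lemma square_integrable_uc: "k \<le> N \<Longrightarrow> square_integrable M (uc v K k)"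
  unfolding uc_def
  by (intro square_integrable_sum square_integrable_matrix_vector_mult square_integrable_xc) auto

lemma square_integrable_control: "k \<le> N \<Longrightarrow> square_integrable M (u v K k)"
  unfolding control_eq
  by (intro square_integrable_add square_integrable_const square_integrable_uc)

lemma square_integrable_resid: "k \<le> N \<Longrightarrow> square_integrable M (resid v K k)"
  unfolding resid_def
  by (intro square_integrable_diff square_integrable_matrix_vector_mult square_integrable_uc
      square_integrable_xc)

lemma mean_xc: "k \<le> N \<Longrightarrow> mean M (xc v K k) = 0"
  unfolding xc_def by (intro integral_centered square_integrable_state)

lemma integral_matrix_vector_mult:
  fixes W :: "real^'p^'q"
  shows "square_integrable M X \<Longrightarrow> (\<integral>\<omega>. W *v X \<omega> \<partial>M) = W *v mean M X"
  by (intro integral_bounded_linear square_integrable_imp_integrable) auto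

lemma mean_uc: "k \<le> N \<Longrightarrow> mean M (uc v K k) = 0"
  unfolding uc_def
  by (subst Bochner_Integration.integral_sum)
    (auto simp: integral_matrix_vector_mult mean_xc square_integrable_xc
      intro!: square_integrable_imp_integrable square_integrable_matrix_vector_mult)

lemma mean_control: "k \<le> N \<Longrightarrow> mean M (u v K k) = v k"
  unfolding control_eq
  by (simp add: square_integrable_imp_integrable square_integrable_uc mean_uc prob_space)

lemma centered_control: "k \<le> N \<Longrightarrow> u v K k \<omega> - mean M (u v K k) = uc v K k \<omega>"
  by (simp add: mean_control) (simp add: control_eq)

lemma mean_state_Suc:
  assumes "k < N"
  shows "mean M (x v K (Suc k)) = A k *v mean M (x v K k) + B k *v v k"
  using assms unfolding state_Suc
  by (simp add: square_integrable_imp_integrable square_integrable_matrix_vector_mult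
      square_integrable_state square_integrable_control square_integrable_noise
      integral_matrix_vector_mult mean_control mean_noise)

text \<open>The feedback acts on centred states and averages to zero, so the recursion of the means
  contains \<open>v\<close> but no gain.\<close>

lemma mean_state_cong: "k \<le> N \<Longrightarrow> mean M (x v K k) = mean M (x v K' k)"
  by (induction k) (simp_all add: mean_state_Suc del: state.simps(2))

lemma xc_Suc:
  assumes "k < N"
  shows "xc v K (Suc k) = (\<lambda>\<omega>. A k *v xc v K k \<omega> + B k *v uc v K k \<omega> + G k *v w k \<omega>)"
  unfolding xc_def mean_state_Suc[OF assms] unfolding state_Suc control_eq
  by (simp add: fun_eq_iff matrix_vector_right_distrib matrix_vector_mult_diff_distrib)

text \<open>A state at time \<open>i\<close> is built linearly from the initial state and the noises
  before \<open>i\<close>, all orthogonal to \<open>w k\<close> when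
  \<open>i \<le> k\<close>.\<close>

lemma orthogonal_xc_noise: "i \<le> k \<Longrightarrow> k < N \<Longrightarrow> orthogonal_rv M (xc v K i) (w k)"
proof (induction i rule: less_induct)
  case (less i)
  note w = square_integrable_noise[OF less.prems(2)]
  show ?case
  proof (cases i)
    case 0
    \<comment> \<open>Orthogonality is assumed for the uncentred \<open>x0\<close>; its mean may be
      subtracted because \<open>w k\<close> has mean zero.\<close>
    have "orthogonal_rv M (\<lambda>_. - mean M x0) (w k)"
      using w mean_noise[OF less.prems(2)]
      by (intro orthogonal_rv_const square_integrable_imp_integrable)
    from orthogonal_rv_add[OF square_integrable_initial square_integrable_const w
        orthogonal_initial_noise[OF less.prems(2)] this]
    show ?thesis unfolding 0 by (simp add: xc_def)
  next
    case (Suc j)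
    have "orthogonal_rv M (uc v K j) (w k)"
      using less Suc unfolding uc_def
      by (intro orthogonal_rv_sum orthogonal_rv_matrix_vector_mult w
          square_integrable_matrix_vector_mult square_integrable_xc) auto
    then show ?thesis
      using less Suc unfolding Suc
      by (subst xc_Suc) (auto intro!: orthogonal_rv_add orthogonal_rv_matrix_vector_mult w
          square_integrable_matrix_vector_mult square_integrable_xc square_integrable_uc
          square_integrable_add square_integrable_noise orthogonal_noise)
  qed
qed

lemma orthogonal_uc_noise: "i \<le> k \<Longrightarrow> k < N \<Longrightarrow> orthogonal_rv M (uc v K i) (w k)"
  unfolding uc_def
  by (intro orthogonal_rv_sum orthogonal_rv_matrix_vector_mult square_integrable_noise
      square_integrable_matrix_vector_mult square_integrable_xc orthogonal_xc_noise) auto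

text \<open>The latest state is the only one containing the latest noise, so testing against that noise
  removes its coefficient.\<close>

lemma history_linearly_independent:
  assumes "k \<le> N" "AE \<omega> in M. (\<Sum>i\<le>k. c i \<bullet> xc v K i \<omega>) = 0" "i \<le> k"
  shows "c i = 0"
  using assms
proof (induction k arbitrary: c i)
  case 0
  then have "AE \<omega> in M. c 0 \<bullet> xc v K 0 \<omega> = 0" by simp
  then have "(\<integral>\<omega>. (c 0 \<bullet> xc v K 0 \<omega>)\<^sup>2 \<partial>M) = 0"
    by (intro integral_eq_zero_AE) auto
  then have "c 0 \<bullet> (P0 *v c 0) = 0"
    by (simp add: xc_def initial_variance)
  then show ?case using pd_quadratic_eq_0_iff[OF pd_P0] 0 by simp
next
  case (Suc k)
  let ?a = "c (Suc k)"
  \<comment> \<open>This is the coefficient vector of \<open>w k\<close> in the whole linear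
    combination; \<open>Y\<close> collects the part of the newest state known before that noise
    acts.\<close>
  define g where "g = transpose (G k) *v ?a"
  define Y where "Y = (\<lambda>\<omega>. A k *v xc v K k \<omega> + B k *v uc v K k \<omega>)"
  have k: "k < N" using Suc.prems by simp
  note w = square_integrable_noise[OF k]
  have Y: "square_integrable M Y" "orthogonal_rv M Y (w k)"
    unfolding Y_def using k
    by (auto intro!: orthogonal_rv_add orthogonal_rv_matrix_vector_mult w square_integrable_add
        square_integrable_matrix_vector_mult square_integrable_xc square_integrable_uc
        orthogonal_xc_noise orthogonal_uc_noise)
  have xs: "?a \<bullet> xc v K (Suc k) \<omega> = ?a \<bullet> Y \<omega> + g \<bullet> w k \<omega>" for \<omega>
    unfolding xc_Suc[OF k] by (simp add: Y_def g_def inner_add_right inner_matrix_vector_mult_left)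
  \<comment> \<open>The vanishing combination is multiplied by
    \<open>g \<bullet> w k \<omega>\<close> and integrated. Orthogonality removes everything except
    the last product, whose expectation is \<open>g \<bullet> g\<close>.\<close>
  have "(\<integral>\<omega>. (\<Sum>i\<le>k. (c i \<bullet> xc v K i \<omega>) * (g \<bullet> w k \<omega>)) + (?a \<bullet> Y \<omega>) * (g \<bullet> w k \<omega>)
        + (g \<bullet> w k \<omega>) * (g \<bullet> w k \<omega>) \<partial>M) = 0"
  proof (rule integral_eq_zero_AE)
    show "AE \<omega> in M. (\<Sum>i\<le>k. (c i \<bullet> xc v K i \<omega>) * (g \<bullet> w k \<omega>)) + (?a \<bullet> Y \<omega>) * (g \<bullet> w k \<omega>)
        + (g \<bullet> w k \<omega>) * (g \<bullet> w k \<omega>) = 0"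
      using Suc.prems(2)
    proof eventually_elim
      case (elim \<omega>)
      then have "((\<Sum>i\<le>k. c i \<bullet> xc v K i \<omega>) + ?a \<bullet> Y \<omega> + g \<bullet> w k \<omega>) * (g \<bullet> w k \<omega>) = 0"
        by (simp add: xs)
      then show ?case by (simp only: distrib_right sum_distrib_right)
    qed
  qed
  moreover have "(\<integral>\<omega>. (g \<bullet> w k \<omega>) * (g \<bullet> w k \<omega>) \<partial>M) = g \<bullet> g"
    using noise_variance[OF k, of g] by (simp add: power2_eq_square)
  moreover have "integrable M (\<lambda>\<omega>. (c i \<bullet> xc v K i \<omega>) * (g \<bullet> w k \<omega>))" if "i \<le> k" for i
    using that k by (intro integrable_inner_mult_inner square_integrable_xc w) auto
  then have "integrable M (\<lambda>\<omega>. \<Sum>i\<le>k. (c i \<bullet> xc v K i \<omega>) * (g \<bullet> w k \<omega>))"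
    and "(\<integral>\<omega>. (\<Sum>i\<le>k. (c i \<bullet> xc v K i \<omega>) * (g \<bullet> w k \<omega>)) \<partial>M) = 0"
    using k by (auto simp: orthogonal_rvD orthogonal_xc_noise)
  ultimately have "g \<bullet> g = 0"
    using integrable_inner_mult_inner[OF Y(1) w, of ?a g] orthogonal_rvD[OF Y(2), of ?a g]
      integrable_inner_mult_inner[OF w w, of g g]
    by (simp only: Bochner_Integration.integral_add Bochner_Integration.integrable_add)
  moreover have "g \<bullet> g = ?a \<bullet> ((G k ** transpose (G k)) *v ?a)"
    by (simp add: g_def matrix_vector_mul_assoc[symmetric] inner_matrix_vector_mult_left)
  ultimately have a: "?a = 0" using pd_quadratic_eq_0_iff[OF pd_noise[OF k]] by metis
  then have "AE \<omega> in M. (\<Sum>i\<le>k. c i \<bullet> xc v K i \<omega>) = 0" using Suc.prems(2) by simp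
  then have "c i = 0" if "i \<le> k" for i using Suc.IH[of c i] that k by simp
  then show ?case using a Suc.prems(3) by (cases "i = Suc k") auto
qed

text \<open>Testing the vector relation with a functional \<open>a\<close> gives a scalar relation
  with coefficients \<open>transpose (L i) *v a\<close>, so the scalar case applies for every
  \<open>a\<close>.\<close>

lemma history_gains_zero:
  fixes L :: "nat \<Rightarrow> real^'n^'p"
  assumes "k \<le> N" "AE \<omega> in M. (\<Sum>i\<le>k. L i *v xc v K i \<omega>) = 0" "i \<le> k"
  shows "L i = 0"
proof -
  have "transpose (L i) *v a = 0" for a
  proof (rule history_linearly_independent[of k "\<lambda>i. transpose (L i) *v a" v K i])
    show "AE \<omega> in M. (\<Sum>i\<le>k. (transpose (L i) *v a) \<bullet> xc v K i \<omega>) = 0"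
      using assms(2)
    proof eventually_elim
      case (elim \<omega>)
      have "(\<Sum>i\<le>k. (transpose (L i) *v a) \<bullet> xc v K i \<omega>) = a \<bullet> (\<Sum>i\<le>k. L i *v xc v K i \<omega>)"
        by (simp add: inner_sum_right inner_matrix_vector_mult_left)
      then show ?case using elim by simp
    qed
  qed (use assms in auto)
  then have "a \<bullet> (L i *v b) = a \<bullet> 0" for a b
    by (simp add: inner_matrix_vector_mult_left)
  then have "L i *v b = 0" for b by (metis vector_eq_ldot)
  then show ?thesis by (simp add: matrix_eq)
qed

section \<open>The regression residual and the variance comparison\<close>

text \<open>A direction of zero variance would be an almost sure linear relation among the history
  whose only nonzero coefficient sits at time \<open>k\<close>.\<close>

lemma pd_cov_state:
  assumes "k \<le> N"
  shows "pd (cov M (x v K k))"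
  unfolding pd_def
proof (intro conjI allI impI)
  note sx = square_integrable_state[OF assms, of v K]
  show "transpose (cov M (x v K k)) = cov M (x v K k)" by (rule transpose_cov[OF sx])
  fix a :: "real^'n" assume a: "a \<noteq> 0"
  have eq: "a \<bullet> (cov M (x v K k) *v a) = (\<integral>\<omega>. (a \<bullet> xc v K k \<omega>)\<^sup>2 \<partial>M)"
    by (simp add: cov_inner sx xc_def)
  have int: "integrable M (\<lambda>\<omega>. (a \<bullet> xc v K k \<omega>)\<^sup>2)"
    using integrable_inner_mult_inner[OF square_integrable_xc square_integrable_xc, OF assms assms]
    by (simp add: power2_eq_square)
  show "0 < a \<bullet> (cov M (x v K k) *v a)"
  proof (rule ccontr)
    assume "\<not> ?thesis"
    then have "(\<integral>\<omega>. (a \<bullet> xc v K k \<omega>)\<^sup>2 \<partial>M) = 0"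
      unfolding eq by (intro antisym integral_nonneg_AE) auto
    then have ae: "AE \<omega> in M. a \<bullet> xc v K k \<omega> = 0"
      using int by (simp add: integral_nonneg_eq_0_iff_AE)
    have "(\<Sum>i\<le>k. (if i = k then a else 0) \<bullet> y i) = a \<bullet> y k" for y
      by (simp add: if_distrib[of "\<lambda>c. c \<bullet> _"] cong: if_cong)
    then have "(if k = k then a else 0) = 0"
      using history_linearly_independent[of k "\<lambda>i. if i = k then a else 0" v K k] ae assms
      by simp
    then show False using a by simp
  qed
qed

text \<open>These are the normal equations of linear regression: the state covariance is invertible,
  so the gain times it gives back the cross-covariance of control and state.\<close>

lemma orthogonal_resid_state:
  assumes "k \<le> N"
  shows "orthogonal_rv M (resid v K k) (xc v K k)"
  unfolding orthogonal_rv_def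
proof (intro allI)
  fix a b
  let ?H = "gain v K k" and ?P = "cov M (x v K k)" and ?C = "cross_cov M (u v K k) (x v K k)"
  note sx = square_integrable_state[OF assms, of v K] and su = square_integrable_control[OF assms, of v K]
    and sxc = square_integrable_xc[OF assms, of v K] and suc = square_integrable_uc[OF assms, of v K]
  have "?H ** ?P = ?C ** (pinv ?P ** ?P)"
    by (simp add: regression_gain_def matrix_mul_assoc)
  then have HP: "?H ** ?P = ?C" by (simp add: pd_pinv_mult pd_cov_state assms)
  have "(\<integral>\<omega>. (a \<bullet> resid v K k \<omega>) * (b \<bullet> xc v K k \<omega>) \<partial>M)
      = (\<integral>\<omega>. (a \<bullet> uc v K k \<omega>) * (b \<bullet> xc v K k \<omega>) \<partial>M)
        - (\<integral>\<omega>. ((transpose ?H *v a) \<bullet> xc v K k \<omega>) * (b \<bullet> xc v K k \<omega>) \<partial>M)"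
    by (simp add: resid_def inner_diff_right left_diff_distrib inner_matrix_vector_mult_left
        integrable_inner_mult_inner sxc suc)
  also have "\<dots> = a \<bullet> (?C *v b) - (transpose ?H *v a) \<bullet> (?P *v b)"
    by (simp add: cross_cov_inner sx su centered_control assms) (simp add: xc_def)
  also have "(transpose ?H *v a) \<bullet> (?P *v b) = a \<bullet> ((?H ** ?P) *v b)"
    by (simp add: matrix_vector_mul_assoc[symmetric] inner_matrix_vector_mult_left)
  finally show "(\<integral>\<omega>. (a \<bullet> resid v K k \<omega>) * (b \<bullet> xc v K k \<omega>) \<partial>M) = 0"
    by (simp add: HP)
qed

lemma uc_resid: "uc v K k = (\<lambda>\<omega>. gain v K k *v xc v K k \<omega> + resid v K k \<omega>)"
  by (simp add: resid_def)

lemma uc_markov: "k < N \<Longrightarrow> uc v (markov v K) k = (\<lambda>\<omega>. gain v K k *v xc v (markov v K) k \<omega>)"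
proof -
  assume k: "k < N"
  have "uc v (markov v K) k \<omega> = (\<Sum>i\<le>k. if i = k then gain v K k *v xc v (markov v K) k \<omega> else 0)" for \<omega>
    unfolding uc_def using k by (intro sum.cong) (auto simp: blkdiag_zero_def)
  then show ?thesis by (simp add: fun_eq_iff)
qed

text \<open>Both loops have the same transition matrix and the same noise, but the loop under
  \<open>K\<close> carries the extra term \<open>B k *v resid v K k \<omega>\<close>. This term is
  orthogonal to the current centred state and to the noise, so it can only add variance.\<close>

lemma markov_state_variance_le:
  "k \<le> N \<Longrightarrow> (\<integral>\<omega>. (a \<bullet> xc v (markov v K) k \<omega>)\<^sup>2 \<partial>M) \<le> (\<integral>\<omega>. (a \<bullet> xc v K k \<omega>)\<^sup>2 \<partial>M)"
proof (induction k arbitrary: a)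
  case 0
  then show ?case by (simp add: xc_def)
next
  case (Suc k)
  then have k: "k < N" "k \<le> N" by simp_all
  let ?L = "markov v K" and ?H = "gain v K k"
  define W where "W = A k + B k ** ?H"
  note w = square_integrable_noise[OF k(1)]
  have L: "xc v ?L (Suc k) = (\<lambda>\<omega>. W *v xc v ?L k \<omega> + G k *v w k \<omega>)"
    unfolding xc_Suc[OF k(1)] uc_markov[OF k(1)] W_def
    by (simp add: matrix_vector_mult_add_rdistrib matrix_vector_mul_assoc)
  have K: "xc v K (Suc k) = (\<lambda>\<omega>. (W *v xc v K k \<omega> + B k *v resid v K k \<omega>) + G k *v w k \<omega>)"
    unfolding xc_Suc[OF k(1)] uc_resid W_def
    by (simp add: matrix_vector_mult_add_rdistrib matrix_vector_mul_assoc matrix_vector_right_distrib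
        add.assoc)
  have int: "square_integrable M (\<lambda>\<omega>. G k *v w k \<omega>)" "square_integrable M (\<lambda>\<omega>. W *v xc v J k \<omega>)"
    "square_integrable M (\<lambda>\<omega>. B k *v resid v J k \<omega>)" for J
    by (intro square_integrable_matrix_vector_mult w square_integrable_xc square_integrable_resid k)+
  have orth_w: "orthogonal_rv M X (\<lambda>\<omega>. G k *v w k \<omega>)" if "orthogonal_rv M X (w k)"
    for X :: "'a \<Rightarrow> real^'n"
    by (rule orthogonal_rv_sym, rule orthogonal_rv_matrix_vector_mult, rule orthogonal_rv_sym)
      (rule that)
  have "orthogonal_rv M (resid v K k) (w k)"
    unfolding resid_def
    by (intro orthogonal_rv_diff orthogonal_rv_matrix_vector_mult orthogonal_uc_noise
        orthogonal_xc_noise square_integrable_matrix_vector_mult square_integrable_uc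
        square_integrable_xc w k order_refl)
  then have oK: "orthogonal_rv M (\<lambda>\<omega>. W *v xc v K k \<omega> + B k *v resid v K k \<omega>) (\<lambda>\<omega>. G k *v w k \<omega>)"
    by (intro orth_w orthogonal_rv_add int w orthogonal_rv_matrix_vector_mult
        orthogonal_xc_noise k order_refl)
  have oL: "orthogonal_rv M (\<lambda>\<omega>. W *v xc v ?L k \<omega>) (\<lambda>\<omega>. G k *v w k \<omega>)"
    by (intro orth_w orthogonal_rv_matrix_vector_mult orthogonal_xc_noise k order_refl)
  have oR: "orthogonal_rv M (\<lambda>\<omega>. W *v xc v K k \<omega>) (\<lambda>\<omega>. B k *v resid v K k \<omega>)"
    by (rule orthogonal_rv_matrix_vector_mult, rule orthogonal_rv_sym,
        rule orthogonal_rv_matrix_vector_mult, rule orthogonal_resid_state[OF k(2)])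
  have "(\<integral>\<omega>. (a \<bullet> xc v ?L (Suc k) \<omega>)\<^sup>2 \<partial>M)
      = (\<integral>\<omega>. (a \<bullet> (W *v xc v ?L k \<omega>))\<^sup>2 \<partial>M) + (\<integral>\<omega>. (a \<bullet> (G k *v w k \<omega>))\<^sup>2 \<partial>M)"
    unfolding L using int oL by (intro integral_square_inner_orthogonal_add)
  \<comment> \<open>The induction hypothesis is used in direction \<open>transpose W *v a\<close>,
    which is why the direction is generalised in the induction.\<close>
  moreover have "(\<integral>\<omega>. (a \<bullet> (W *v xc v ?L k \<omega>))\<^sup>2 \<partial>M) \<le> (\<integral>\<omega>. (a \<bullet> (W *v xc v K k \<omega>))\<^sup>2 \<partial>M)"
    using Suc.IH[OF k(2)] by (simp add: inner_matrix_vector_mult_left)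
  moreover have "0 \<le> (\<integral>\<omega>. (a \<bullet> (B k *v resid v K k \<omega>))\<^sup>2 \<partial>M)"
    by simp
  moreover have "(\<integral>\<omega>. (a \<bullet> (W *v xc v K k \<omega> + B k *v resid v K k \<omega>))\<^sup>2 \<partial>M)
      = (\<integral>\<omega>. (a \<bullet> (W *v xc v K k \<omega>))\<^sup>2 \<partial>M) + (\<integral>\<omega>. (a \<bullet> (B k *v resid v K k \<omega>))\<^sup>2 \<partial>M)"
    using int oR by (intro integral_square_inner_orthogonal_add)
  moreover have "(\<integral>\<omega>. (a \<bullet> xc v K (Suc k) \<omega>)\<^sup>2 \<partial>M)
      = (\<integral>\<omega>. (a \<bullet> (W *v xc v K k \<omega> + B k *v resid v K k \<omega>))\<^sup>2 \<partial>M)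
        + (\<integral>\<omega>. (a \<bullet> (G k *v w k \<omega>))\<^sup>2 \<partial>M)"
    unfolding K using int oK
    by (intro integral_square_inner_orthogonal_add square_integrable_add)
  ultimately show ?case by linarith
qed

lemma orthogonal_gain_resid:
  "k \<le> N \<Longrightarrow> orthogonal_rv M (\<lambda>\<omega>. gain v K k *v xc v K k \<omega>) (resid v K k)"
  by (intro orthogonal_rv_matrix_vector_mult)
    (rule orthogonal_rv_sym, rule orthogonal_resid_state)

text \<open>The gain turns \<open>a\<close> into a direction in state space, where variances are
  already compared; under \<open>K\<close> the orthogonal residual adds a nonnegative
  amount.\<close>

lemma markov_control_variance_le:
  assumes "k < N"
  shows "(\<integral>\<omega>. (a \<bullet> uc v (markov v K) k \<omega>)\<^sup>2 \<partial>M) \<le> (\<integral>\<omega>. (a \<bullet> uc v K k \<omega>)\<^sup>2 \<partial>M)"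
proof -
  have k: "k \<le> N" using assms by simp
  have "(\<integral>\<omega>. (a \<bullet> uc v (markov v K) k \<omega>)\<^sup>2 \<partial>M) \<le> (\<integral>\<omega>. (a \<bullet> (gain v K k *v xc v K k \<omega>))\<^sup>2 \<partial>M)"
    using markov_state_variance_le[OF k]
    by (simp add: uc_markov[OF assms] inner_matrix_vector_mult_left)
  also have "\<dots> \<le> (\<integral>\<omega>. (a \<bullet> (gain v K k *v xc v K k \<omega>))\<^sup>2 \<partial>M) + (\<integral>\<omega>. (a \<bullet> resid v K k \<omega>)\<^sup>2 \<partial>M)"
    by simp
  also have "\<dots> = (\<integral>\<omega>. (a \<bullet> uc v K k \<omega>)\<^sup>2 \<partial>M)"
    unfolding uc_resid
    by (intro integral_square_inner_orthogonal_add[symmetric] square_integrable_matrix_vector_mult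
        square_integrable_xc square_integrable_resid orthogonal_gain_resid k)
  finally show ?thesis .
qed

section \<open>Feasibility, cost and uniqueness of the optimal gains\<close>

text \<open>Both policies produce the same means, so only the covariance argument of each constraint
  changes, and it decreases in the Loewner order.\<close>

lemma markov_feasible:
  assumes "covariance_monotonic gx" "covariance_monotonic gu"
    and "feasible M N A B G x0 w gx gu v K"
  shows "feasible M N A B G x0 w gx gu v (markov v K)"
  unfolding feasible_def
proof (intro conjI ballI allI impI)
  let ?L = "markov v K"
  fix k assume k: "k \<in> {1..N}"
  then have sx: "square_integrable M (x v J k)" for J by (intro square_integrable_state) auto
  have "loewner_le (cov M (x v ?L k)) (cov M (x v K k))"
    using markov_state_variance_le[of k] k
    by (intro loewner_le_cov sx) (simp add: xc_def)
  then have "gx (mean M (x v K k)) (cov M (x v ?L k)) \<le> gx (mean M (x v K k)) (cov M (x v K k))"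
    using assms(1) psd_cov[OF sx] unfolding covariance_monotonic_def by blast
  then show "gx (mean M (x v ?L k)) (cov M (x v ?L k)) \<le> 0"
    using assms(3) k mean_state_cong[of k v ?L K] by (force simp: feasible_def)
next
  let ?L = "markov v K"
  fix k assume k: "k < N"
  then have su: "square_integrable M (u v J k)" for J by (intro square_integrable_control) auto
  have "loewner_le (cov M (u v ?L k)) (cov M (u v K k))"
    using markov_control_variance_le k
    by (intro loewner_le_cov su) (simp add: centered_control)
  then have "gu (v k) (cov M (u v ?L k)) \<le> gu (v k) (cov M (u v K k))"
    using assms(2) psd_cov[OF su] unfolding covariance_monotonic_def by blast
  then show "gu (mean M (u v ?L k)) (cov M (u v ?L k)) \<le> 0"
    using assms(3) k mean_control[of k v] by (force simp: feasible_def)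
qed (simp add: block_lower_triangular_def blkdiag_zero_def)

text \<open>The contributions of the means agree. Centred state terms do not increase, and each
  control term splits by Pythagoras into a gain part and a residual part, so the residual cost
  survives as the gap.\<close>

lemma markov_cost_le:
  assumes "\<And>k. k \<le> N \<Longrightarrow> psd (Q k)" and "\<And>k. k < N \<Longrightarrow> psd (R k)"
  shows "cost M A B G x0 w v (markov v K) N Q R
      + (\<Sum>k<N. \<integral>\<omega>. resid v K k \<omega> \<bullet> (R k *v resid v K k \<omega>) \<partial>M)
    \<le> cost M A B G x0 w v K N Q R"
proof -
  let ?L = "markov v K"
  have state: "(\<integral>\<omega>. x v ?L k \<omega> \<bullet> (Q k *v x v ?L k \<omega>) \<partial>M)
      \<le> (\<integral>\<omega>. x v K k \<omega> \<bullet> (Q k *v x v K k \<omega>) \<partial>M)" if k: "k \<le> N" for k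
  proof -
    have eq: "(\<integral>\<omega>. x v J k \<omega> \<bullet> (Q k *v x v J k \<omega>) \<partial>M)
        = (\<integral>\<omega>. xc v J k \<omega> \<bullet> (Q k *v xc v J k \<omega>) \<partial>M) + mean M (x v J k) \<bullet> (Q k *v mean M (x v J k))" for J
      using assms(1)[OF k] unfolding xc_def
      by (intro integral_quadratic_mean square_integrable_state k) (simp add: psd_def)
    show ?thesis
      unfolding eq mean_state_cong[OF k, of v ?L K]
      by (intro add_right_mono integral_quadratic_mono assms(1) square_integrable_xc
          markov_state_variance_le k)
  qed
  have control: "(\<integral>\<omega>. u v ?L k \<omega> \<bullet> (R k *v u v ?L k \<omega>) \<partial>M)
      + (\<integral>\<omega>. resid v K k \<omega> \<bullet> (R k *v resid v K k \<omega>) \<partial>M)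
      \<le> (\<integral>\<omega>. u v K k \<omega> \<bullet> (R k *v u v K k \<omega>) \<partial>M)" if k': "k < N" for k
  proof -
    have k: "k \<le> N" using k' by simp
    let ?H = "gain v K k"
    have R: "transpose (R k) = R k" using assms(2)[OF k'] by (simp add: psd_def)
    have eq: "(\<integral>\<omega>. u v J k \<omega> \<bullet> (R k *v u v J k \<omega>) \<partial>M)
        = (\<integral>\<omega>. uc v J k \<omega> \<bullet> (R k *v uc v J k \<omega>) \<partial>M) + v k \<bullet> (R k *v v k)" for J
      using integral_quadratic_mean[OF R square_integrable_control[OF k], of v J]
      by (simp add: centered_control k) (simp add: mean_control k)
    have "(\<integral>\<omega>. uc v ?L k \<omega> \<bullet> (R k *v uc v ?L k \<omega>) \<partial>M)
        \<le> (\<integral>\<omega>. (?H *v xc v K k \<omega>) \<bullet> (R k *v (?H *v xc v K k \<omega>)) \<partial>M)"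
      unfolding uc_markov[OF k']
      by (intro integral_quadratic_mono assms(2) k' square_integrable_matrix_vector_mult
          square_integrable_xc k)
        (simp add: inner_matrix_vector_mult_left markov_state_variance_le k)
    moreover have "(\<integral>\<omega>. uc v K k \<omega> \<bullet> (R k *v uc v K k \<omega>) \<partial>M)
        = (\<integral>\<omega>. (?H *v xc v K k \<omega>) \<bullet> (R k *v (?H *v xc v K k \<omega>)) \<partial>M)
          + (\<integral>\<omega>. resid v K k \<omega> \<bullet> (R k *v resid v K k \<omega>) \<partial>M)"
      unfolding uc_resid
      by (intro integral_quadratic_orthogonal_add R square_integrable_matrix_vector_mult
          square_integrable_xc square_integrable_resid orthogonal_gain_resid k)
    ultimately show ?thesis unfolding eq by simp
  qed
  have "(\<Sum>k\<le>N. \<integral>\<omega>. x v ?L k \<omega> \<bullet> (Q k *v x v ?L k \<omega>) \<partial>M)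
      \<le> (\<Sum>k\<le>N. \<integral>\<omega>. x v K k \<omega> \<bullet> (Q k *v x v K k \<omega>) \<partial>M)"
    by (intro sum_mono state) auto
  moreover have "(\<Sum>k<N. \<integral>\<omega>. u v ?L k \<omega> \<bullet> (R k *v u v ?L k \<omega>) \<partial>M)
      + (\<Sum>k<N. \<integral>\<omega>. resid v K k \<omega> \<bullet> (R k *v resid v K k \<omega>) \<partial>M)
      \<le> (\<Sum>k<N. \<integral>\<omega>. u v K k \<omega> \<bullet> (R k *v u v K k \<omega>) \<partial>M)"
    unfolding sum.distrib[symmetric] by (intro sum_mono control) auto
  ultimately show ?thesis unfolding cost_def by linarith
qed

lemma optimal_imp_markov:
  assumes Q: "\<And>k. k \<le> N \<Longrightarrow> psd (Q k)" and R: "\<And>k. k < N \<Longrightarrow> pd (R k)"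
    and g: "covariance_monotonic gx" "covariance_monotonic gu"
    and opt: "optimal M N A B G x0 w gx gu Q R v K"
  shows "block_matrix_eq N K (markov v K)"
  unfolding block_matrix_eq_def
proof (intro allI impI)
  fix k i assume k': "k < N" and i: "i \<le> N"
  then have k: "k \<le> N" by simp
  let ?H = "gain v K k"
  define r where "r k = (\<integral>\<omega>. resid v K k \<omega> \<bullet> (R k *v resid v K k \<omega>) \<partial>M)" for k
  have nonneg: "0 \<le> y \<bullet> (R k *v y)" if "k < N" for k y
    using pd_imp_psd[OF R[OF that]] by (simp add: psd_def)
  have feas: "feasible M N A B G x0 w gx gu v K" using opt by (simp add: optimal_def)
  have "cost M A B G x0 w v K N Q R \<le> cost M A B G x0 w v (markov v K) N Q R"
    using opt markov_feasible[OF g feas] by (simp add: optimal_def)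
  \<comment> \<open>Optimality is tested against one competitor, the Markov policy with the same
    \<open>v\<close>; the cost gap then bounds the total residual cost by zero.\<close>
  then have "(\<Sum>k<N. r k) \<le> 0"
    using markov_cost_le[of Q R v K] Q pd_imp_psd[OF R] by (simp add: r_def)
  moreover have "0 \<le> r k" if "k < N" for k
    unfolding r_def using nonneg[OF that] by (intro integral_nonneg_AE) auto
  ultimately have "r k = 0"
    using k' sum_nonneg_eq_0_iff[of "{..<N}" r]
    by (metis antisym finite_lessThan lessThan_iff sum_nonneg)
  moreover have "integrable M (\<lambda>\<omega>. resid v K k \<omega> \<bullet> (R k *v resid v K k \<omega>))"
    by (intro square_integrable_inner square_integrable_matrix_vector_mult square_integrable_resid k)
  ultimately have "AE \<omega> in M. resid v K k \<omega> \<bullet> (R k *v resid v K k \<omega>) = 0"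
    using nonneg[OF k'] by (simp add: r_def integral_nonneg_eq_0_iff_AE)
  then have ae: "AE \<omega> in M. resid v K k \<omega> = 0"
    by (simp add: pd_quadratic_eq_0_iff[OF R[OF k']])
  \<comment> \<open>The coefficients of the residual in the state history: the gain is subtracted
    from the diagonal block only.\<close>
  define D where "D i = K k i - (if i = k then ?H else 0)" for i
  have "resid v K k \<omega> = (\<Sum>i\<le>k. D i *v xc v K i \<omega>)" for \<omega>
  proof -
    have "(\<Sum>i\<le>k. D i *v xc v K i \<omega>)
        = uc v K k \<omega> - (\<Sum>i\<le>k. (if i = k then ?H else 0) *v xc v K i \<omega>)"
      by (simp add: D_def matrix_vector_mult_diff_rdistrib sum_subtractf uc_def)
    also have "(\<Sum>i\<le>k. (if i = k then ?H else 0) *v xc v K i \<omega>)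
        = (\<Sum>i\<le>k. if i = k then ?H *v xc v K k \<omega> else 0)"
      by (intro sum.cong) auto
    finally show ?thesis by (simp add: resid_def)
  qed
  then have "D i = 0" if "i \<le> k"
    using history_gains_zero[of k D v K i] ae k that by simp
  \<comment> \<open>Blocks above the diagonal, including the last column, never enter the closed
    loop; the block lower triangular constraint fixes them.\<close>
  moreover have "K k i = 0" if "k < i"
    using feas k' i that by (simp add: feasible_def block_lower_triangular_def)
  ultimately show "K k i = markov v K k i"
    using k' by (cases "i \<le> k") (auto simp: D_def blkdiag_zero_def)
qed

end

theorem theorem2:
  fixes M :: "'a measure" and N :: nat
    and A :: "nat \<Rightarrow> real^'n^'n" and B :: "nat \<Rightarrow> real^'m^'n" and G :: "nat \<Rightarrow> real^'l^'n"
    and \<mu>0 :: "real^'n" and P0 :: "real^'n^'n"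
    and x0 :: "'a \<Rightarrow> real^'n" and w :: "nat \<Rightarrow> 'a \<Rightarrow> real^'l"
    and Q :: "nat \<Rightarrow> real^'n^'n" and R :: "nat \<Rightarrow> real^'m^'m"
    and gx :: "real^'n \<Rightarrow> real^'n^'n \<Rightarrow> real" and gu :: "real^'m \<Rightarrow> real^'m^'m \<Rightarrow> real"
    and v :: "nat \<Rightarrow> real^'m" and K :: "nat \<Rightarrow> nat \<Rightarrow> real^'n^'m"
  assumes "noise_model M N \<mu>0 P0 x0 w"
    and "\<And>k. k \<le> N \<Longrightarrow> psd (Q k)"
    and "\<And>k. k < N \<Longrightarrow> pd (R k)"
    and "covariance_monotonic gx" and "covariance_monotonic gu"
    and "pd P0"
    and "\<And>k. k < N \<Longrightarrow> pd (G k ** transpose (G k))"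
    and "optimal M N A B G x0 w gx gu Q R v K"
  shows "block_matrix_eq N K (blkdiag_zero N (regression_gain M A B G x0 w v K))"
proof -
  note m = noise_model_moments[OF assms(1)]
  interpret prob_space M by (rule m(1))
  interpret linear_system M N A B G P0 x0 w
    by unfold_locales (use m(2-) assms(6,7) in auto)
  show ?thesis using assms(2-5,8) by (rule optimal_imp_markov)
qed

end
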